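(* Let $\Gamma$ be a non-empty compact subset of $\mathcal P$ and let $G=\langle\Gamma\rangle$. Suppose that $P^*(G)$ is not bounded in $\mathbb C$. Then there exists a residual subset $\mathcal U$ of $\Gamma^{\mathbb N}$ such that for each $\tau\in\mathfrak M_1(\mathcal P)$ with $\operatorname{supp}\tau=\Gamma$ we have $\tilde\tau(\mathcal U)=1$, and such that for each $\gamma\in\mathcal U$ the Julia set $J_\gamma$ of $\gamma$ has uncountably many connected components.
   Context: $\hat{\mathbb C}$ is the Riemann sphere with spherical distance $d$. $\mathcal P$ is the set of polynomial maps $\hat{\mathbb C}\to\hat{\mathbb C}$ of degree at least $2$, with the metric $\kappa(f,g)=\sup_zd(f(z),g(z))$. $\langle\Gamma\rangle$ is the semigroup generated by $\Gamma$ under composition. For a semigroup $G$ of polynomials, $P(G)=\overline{\bigcup_{g\in G}\{\text{all critical values of }g:\hat{\mathbb C}\to\hat{\mathbb C}\}}$ (closure in $\hat{\mathbb C}$) and $P^*(G)=P(G)\setminus\{\infty\}$. $\Gamma^{\mathbb N}$ has the product topology; a subset of a complete metric space is residual if it contains a countable intersection of open dense subsets. $\mathfrak M_1(\mathcal P)$ is the set of Borel probability measures on $\mathcal P$; $\tilde\tau=\otimes_{j=1}^\infty\tau$. For $\gamma=(\gamma_1,\gamma_2,\dots)$, $J_\gamma$ is the complement in $\hat{\mathbb C}$ of the set of points having a neighborhood on which $\{\gamma_n\circ\cdots\circ\gamma_1\}_{n\in\mathbb N}$ is equicontinuous with respect to $d$. *)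

theory Defs
  imports "HOL-Probability.Probability" "HOL-Computational_Algebra.Polynomial"
begin

section \<open>The Riemann sphere\<close>

datatype riemann_sphere = Fin complex | Infty

text \<open>Inverse stereographic projection onto the unit sphere of \<open>complex \<times> real\<close>.\<close>

definition stereo :: "riemann_sphere \<Rightarrow> complex \<times> real" where
  "stereo p = (case p of
      Fin z \<Rightarrow> (of_real (2 / (1 + (cmod z)\<^sup>2)) * z, ((cmod z)\<^sup>2 - 1) / ((cmod z)\<^sup>2 + 1))
    | Infty \<Rightarrow> (0, 1))"

lemma norm_stereo [simp]: "norm (stereo p) = 1"
proof (cases p)
  case (Fin z)
  define r where "r = (cmod z)\<^sup>2"
  have r: "r \<ge> 0" by (simp add: r_def)
  have "(cmod (of_real (2 / (1 + r)) * z))\<^sup>2 = 4 * r / (1 + r)\<^sup>2"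
    using r by (simp add: norm_mult norm_divide power_mult_distrib power_divide r_def del: of_real_divide)
  moreover have "4 * r / (1 + r)\<^sup>2 + ((r - 1) / (r + 1))\<^sup>2 = 1"
  proof -
    have "4 * r / (1 + r)\<^sup>2 + ((r - 1) / (r + 1))\<^sup>2 = (4 * r + (r - 1)\<^sup>2) / (1 + r)\<^sup>2"
      by (simp add: power_divide add_divide_distrib add.commute)
    also have "4 * r + (r - 1)\<^sup>2 = (1 + r)\<^sup>2"
      by (simp add: power2_eq_square algebra_simps)
    finally show ?thesis using r by simp
  qed
  ultimately have "(cmod (of_real (2 / (1 + r)) * z))\<^sup>2 + ((r - 1) / (r + 1))\<^sup>2 = 1"
    by simp
  then show ?thesis
    unfolding norm_prod_def stereo_def Fin riemann_sphere.case prod.sel real_norm_def power2_abs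
    by (simp only: r_def real_sqrt_one)
qed (simp add: stereo_def norm_prod_def)

lemma inj_stereo: "inj stereo"
proof (rule injI)
  fix p q assume eq: "stereo p = stereo q"
  have key: "1 - ((cmod z)\<^sup>2 - 1) / ((cmod z)\<^sup>2 + 1) = 2 / (1 + (cmod z)\<^sup>2)"
    and pos: "2 / (1 + (cmod z)\<^sup>2) > 0" for z
  proof -
    have "1 + (cmod z)\<^sup>2 > 0" by (simp add: add_pos_nonneg)
    then show "1 - ((cmod z)\<^sup>2 - 1) / ((cmod z)\<^sup>2 + 1) = 2 / (1 + (cmod z)\<^sup>2)"
      and "2 / (1 + (cmod z)\<^sup>2) > 0"
      by (auto simp: field_simps)
  qed
  have ne: "stereo (Fin z) \<noteq> stereo Infty" for z
  proof
    assume "stereo (Fin z) = stereo Infty"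
    then have "((cmod z)\<^sup>2 - 1) / ((cmod z)\<^sup>2 + 1) = 1"
      by (simp add: stereo_def)
    then show False using key[of z] pos[of z] by linarith
  qed
  have "z = w" if e: "stereo (Fin z) = stereo (Fin w)" for z w
  proof -
    have s: "((cmod z)\<^sup>2 - 1) / ((cmod z)\<^sup>2 + 1) = ((cmod w)\<^sup>2 - 1) / ((cmod w)\<^sup>2 + 1)"
      and f: "of_real (2 / (1 + (cmod z)\<^sup>2)) * z = of_real (2 / (1 + (cmod w)\<^sup>2)) * w"
      using arg_cong[OF e, of snd] arg_cong[OF e, of fst]
      unfolding stereo_def riemann_sphere.case prod.sel by auto
    have g: "2 / (1 + (cmod z)\<^sup>2) = 2 / (1 + (cmod w)\<^sup>2)"
      using s key[of z] key[of w] by linarith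
    have "complex_of_real (2 / (1 + (cmod w)\<^sup>2)) \<noteq> 0"
      using pos[of w] by (metis less_irrefl of_real_eq_0_iff)
    with f show ?thesis unfolding g by (metis mult_left_cancel)
  qed
  then show "p = q" using eq ne by (cases p; cases q) (metis)+
qed

lemma arccos_inner_triangle:
  fixes u v w :: "'a::real_inner"
  assumes "norm u = 1" "norm v = 1" "norm w = 1"
  shows "arccos (u \<bullet> w) \<le> arccos (u \<bullet> v) + arccos (v \<bullet> w)"
proof -
  have b: "\<bar>x \<bullet> y\<bar> \<le> 1" if "norm x = 1" "norm y = 1" for x y :: 'a
    using Cauchy_Schwarz_ineq2[of x y] that by simp
  define a where "a = u \<bullet> v"
  define c where "c = v \<bullet> w"
  have ab: "\<bar>a\<bar> \<le> 1" "\<bar>c\<bar> \<le> 1" "\<bar>u \<bullet> w\<bar> \<le> 1"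
    using b assms by (auto simp: a_def c_def)
  have v: "v \<bullet> v = 1" "u \<bullet> u = 1" "w \<bullet> w = 1"
    using assms by (simp_all add: dot_square_norm)
  have n1: "norm (u - a *\<^sub>R v) = sqrt (1 - a\<^sup>2)"
    by (simp add: norm_eq_sqrt_inner inner_diff inner_commute v a_def power2_eq_square algebra_simps)
  have n2: "norm (w - c *\<^sub>R v) = sqrt (1 - c\<^sup>2)"
    by (simp add: norm_eq_sqrt_inner inner_diff inner_commute v c_def power2_eq_square algebra_simps)
  have "(u - a *\<^sub>R v) \<bullet> (w - c *\<^sub>R v) = u \<bullet> w - a * c"
    by (simp add: inner_diff v a_def c_def inner_commute algebra_simps)
  then have "- (sqrt (1 - a\<^sup>2) * sqrt (1 - c\<^sup>2)) \<le> u \<bullet> w - a * c"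
    using Cauchy_Schwarz_ineq2[of "u - a *\<^sub>R v" "w - c *\<^sub>R v"] n1 n2 by simp
  then have le: "cos (arccos a + arccos c) \<le> u \<bullet> w"
    using ab by (simp add: cos_add sin_arccos_abs cos_arccos_abs)
  show ?thesis
  proof (cases "arccos a + arccos c \<le> pi")
    case True
    have "arccos (u \<bullet> w) \<le> arccos (cos (arccos a + arccos c))"
      using le ab by (intro arccos_le_arccos) auto
    also have "\<dots> = arccos a + arccos c"
      using True ab by (intro arccos_cos) (auto intro!: add_nonneg_nonneg arccos_lbound)
    finally show ?thesis by (simp add: a_def c_def)
  next
    case False
    moreover have "arccos (u \<bullet> w) \<le> pi" using ab by (intro arccos_ubound) auto
    ultimately show ?thesis by (simp add: a_def c_def)
  qed
qed

text \<open>The spherical distance is the great-circle distance, that is, the length metric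
  of \<open>2 |dz| / (1 + |z|\<^sup>2)\<close>.\<close>

instantiation riemann_sphere :: metric_space
begin

definition dist_riemann_sphere :: "riemann_sphere \<Rightarrow> riemann_sphere \<Rightarrow> real" where
  "dist_riemann_sphere p q = arccos (stereo p \<bullet> stereo q)"

definition uniformity_riemann_sphere :: "(riemann_sphere \<times> riemann_sphere) filter" where
  "uniformity_riemann_sphere = (INF e\<in>{0<..}. principal {(x, y). dist x y < e})"

definition open_riemann_sphere :: "riemann_sphere set \<Rightarrow> bool" where
  "open_riemann_sphere U = (\<forall>x\<in>U. \<forall>\<^sub>F (x', y) in uniformity. x' = x \<longrightarrow> y \<in> U)"

instance
proof
  fix p q r :: riemann_sphere
  have b: "\<bar>stereo x \<bullet> stereo y\<bar> \<le> 1" for x y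
    using Cauchy_Schwarz_ineq2[of "stereo x" "stereo y"] by simp
  have one: "stereo x \<bullet> stereo x = 1" for x
    by (simp add: dot_square_norm)
  show "dist p q = 0 \<longleftrightarrow> p = q"
  proof
    assume "dist p q = 0"
    then have "stereo p \<bullet> stereo q = 1"
      using b[of p q] cos_arccos_abs[of "stereo p \<bullet> stereo q"] by (simp add: dist_riemann_sphere_def)
    then have "(stereo p - stereo q) \<bullet> (stereo p - stereo q) = 0"
      by (simp add: inner_diff inner_commute one)
    then show "p = q" using inj_stereo by (auto dest: injD)
  qed (simp add: dist_riemann_sphere_def one)
  show "dist p q \<le> dist p r + dist q r"
    using arccos_inner_triangle[of "stereo p" "stereo r" "stereo q"]
    by (simp add: dist_riemann_sphere_def inner_commute)
qed (simp_all add: uniformity_riemann_sphere_def open_riemann_sphere_def)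

end

lemma dist_riemann_sphere_le_pi: "dist p q \<le> pi" for p q :: riemann_sphere
  using Cauchy_Schwarz_ineq2[of "stereo p" "stereo q"]
  by (auto simp: dist_riemann_sphere_def intro!: arccos_ubound)


section \<open>Polynomial maps of degree at least 2\<close>

definition poly_ext :: "complex poly \<Rightarrow> riemann_sphere \<Rightarrow> riemann_sphere" where
  "poly_ext p x = (case x of Fin z \<Rightarrow> Fin (poly p z) | Infty \<Rightarrow> Infty)"

typedef polymap = "{poly_ext p | p. degree p \<ge> 2}"
  morphisms as_map Abs_polymap
  by (auto intro!: exI[of _ "monom 1 2"] simp: degree_monom_eq)

instantiation polymap :: metric_space
begin

definition dist_polymap :: "polymap \<Rightarrow> polymap \<Rightarrow> real" where
  "dist_polymap f g = (SUP x. dist (as_map f x) (as_map g x))"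

definition uniformity_polymap :: "(polymap \<times> polymap) filter" where
  "uniformity_polymap = (INF e\<in>{0<..}. principal {(x, y). dist x y < e})"

definition open_polymap :: "polymap set \<Rightarrow> bool" where
  "open_polymap U = (\<forall>x\<in>U. \<forall>\<^sub>F (x', y) in uniformity. x' = x \<longrightarrow> y \<in> U)"

instance
proof
  fix f g h :: polymap
  have bdd: "bdd_above (range (\<lambda>x. dist (as_map a x) (as_map b x)))" for a b
    by (rule bdd_aboveI2[of _ _ pi]) (rule dist_riemann_sphere_le_pi)
  have up: "dist (as_map a x) (as_map b x) \<le> dist a b" for a b x
    unfolding dist_polymap_def by (rule cSUP_upper[OF _ bdd]) simp
  show "dist f g = 0 \<longleftrightarrow> f = g"
  proof
    assume 0: "dist f g = 0"
    have "as_map f x = as_map g x" for x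
      using up[of f x g] 0 by simp
    then show "f = g" by (auto simp: as_map_inject[symmetric])
  qed (simp add: dist_polymap_def)
  show "dist f g \<le> dist f h + dist g h"
  proof -
    have "dist (as_map f x) (as_map g x) \<le> dist f h + dist g h" for x
      using dist_triangle2[of "as_map f x" "as_map g x" "as_map h x"] up[of f x h] up[of g x h]
      by linarith
    then show ?thesis
      unfolding dist_polymap_def[of f g] by (intro cSUP_least) auto
  qed
qed (simp_all add: uniformity_polymap_def open_polymap_def)

end

inductive_set generated_semigroup :: "('a \<Rightarrow> 'a) set \<Rightarrow> ('a \<Rightarrow> 'a) set" for \<Gamma> where
  gen: "f \<in> \<Gamma> \<Longrightarrow> f \<in> generated_semigroup \<Gamma>"
| comp: "f \<in> generated_semigroup \<Gamma> \<Longrightarrow> g \<in> generated_semigroup \<Gamma> \<Longrightarrow> f \<circ> g \<in> generated_semigroup \<Gamma>"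


section \<open>Critical values and the postcritical set\<close>

text \<open>The coordinate near \<open>a\<close> is \<open>z\<close> if \<open>a\<close> is finite and \<open>1/z\<close> if \<open>a = Infty\<close>.
  The values of \<open>coord a\<close> at the point outside the domain of the chart are junk
  and never matter, since \<open>coord\<close> is only used in a neighbourhood of \<open>a\<close>.\<close>

definition coord :: "riemann_sphere \<Rightarrow> riemann_sphere \<Rightarrow> complex" where
  "coord a x = (case a of
      Fin _ \<Rightarrow> (case x of Fin z \<Rightarrow> z | Infty \<Rightarrow> 0)
    | Infty \<Rightarrow> (case x of Fin z \<Rightarrow> 1 / z | Infty \<Rightarrow> 0))"

definition coord_inv :: "riemann_sphere \<Rightarrow> complex \<Rightarrow> riemann_sphere" where
  "coord_inv a w = (case a of
      Fin _ \<Rightarrow> Fin w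
    | Infty \<Rightarrow> (if w = 0 then Infty else Fin (1 / w)))"

definition critical_point :: "(riemann_sphere \<Rightarrow> riemann_sphere) \<Rightarrow> riemann_sphere \<Rightarrow> bool" where
  "critical_point g a \<longleftrightarrow>
     ((\<lambda>w. coord (g a) (g (coord_inv a w))) has_field_derivative 0) (at (coord a a))"

definition critical_values :: "(riemann_sphere \<Rightarrow> riemann_sphere) \<Rightarrow> riemann_sphere set" where
  "critical_values g = g ` {a. critical_point g a}"

definition postcritical :: "(riemann_sphere \<Rightarrow> riemann_sphere) set \<Rightarrow> riemann_sphere set" where
  "postcritical G = closure (\<Union>g\<in>G. critical_values g)"

definition planar_postcritical :: "(riemann_sphere \<Rightarrow> riemann_sphere) set \<Rightarrow> riemann_sphere set" where
  "planar_postcritical G = postcritical G - {Infty}"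


section \<open>Julia sets of sequences\<close>

definition equicontinuous_on :: "'a::metric_space set \<Rightarrow> ('a \<Rightarrow> 'b::metric_space) set \<Rightarrow> bool" where
  "equicontinuous_on V F \<longleftrightarrow>
     (\<forall>x\<in>V. \<forall>e>0. \<exists>d>0. \<forall>f\<in>F. \<forall>y\<in>V. dist y x < d \<longrightarrow> dist (f y) (f x) < e)"

text \<open>Sequences are indexed from 0: \<open>\<gamma> 0, \<gamma> 1, \<dots>\<close> stand for \<open>\<gamma>\<^sub>1, \<gamma>\<^sub>2, \<dots>\<close>, so
  \<open>seq_comp \<gamma> n\<close> is \<open>\<gamma>\<^sub>n \<circ> \<dots> \<circ> \<gamma>\<^sub>1\<close>.\<close>

primrec seq_comp :: "(nat \<Rightarrow> polymap) \<Rightarrow> nat \<Rightarrow> riemann_sphere \<Rightarrow> riemann_sphere" where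
  "seq_comp \<gamma> 0 = id"
| "seq_comp \<gamma> (Suc n) = as_map (\<gamma> n) \<circ> seq_comp \<gamma> n"

definition fatou :: "(nat \<Rightarrow> polymap) \<Rightarrow> riemann_sphere set" where
  "fatou \<gamma> = {z. \<exists>V. open V \<and> z \<in> V \<and> equicontinuous_on V {seq_comp \<gamma> n | n. n \<ge> 1}}"

definition julia :: "(nat \<Rightarrow> polymap) \<Rightarrow> riemann_sphere set" where
  "julia \<gamma> = - fatou \<gamma>"


section \<open>Residual sets and supports of measures\<close>

definition residual_in :: "'a topology \<Rightarrow> 'a set \<Rightarrow> bool" where
  "residual_in X U \<longleftrightarrow> U \<subseteq> topspace X \<and>
     (\<exists>W :: nat \<Rightarrow> 'a set. (\<forall>n. openin X (W n) \<and> X closure_of W n = topspace X) \<and> (\<Inter>n. W n) \<subseteq> U)"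

definition measure_support :: "'a::topological_space measure \<Rightarrow> 'a set" where
  "measure_support M = {x. \<forall>V. open V \<and> x \<in> V \<longrightarrow> emeasure M V > 0}"

definition borel_probability :: "'a::topological_space measure \<Rightarrow> bool" where
  "borel_probability M \<longleftrightarrow> prob_space M \<and> sets M = sets borel"

end

theory Submission
  imports Defs "HOL-Complex_Analysis.Complex_Analysis"
    "HOL-Computational_Algebra.Fundamental_Theorem_Algebra"
begin

text \<open>
  Fix a radius \<open>R\<close> outside of which every map in \<open>\<Gamma>\<close> at least doubles the modulus. If the
  planar postcritical set is unbounded, some composition \<open>Q = h\<^sub>N \<circ> \<dots> \<circ> h\<^sub>1\<close> has a critical value
  outside the disc of radius \<open>R\<close>, which forces the lemniscate \<open>{\<bar>Q\<bar> \<le> R}\<close> to be disconnected, and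
  this persists under small perturbations of the \<open>h\<^sub>i\<close>. Let \<open>\<U>\<close> consist of the sequences that pass
  infinitely often close to the word \<open>h\<^sub>1, \<dots>, h\<^sub>N\<close>; this set is residual and has full measure.
  Along a sequence in \<open>\<U>\<close>, each such passage splits every relatively clopen piece of the preimage
  of the disc, because such a piece is mapped onto the disc. The infinite itineraries of choices
  yield uncountably many nonempty compact sets, pairwise separated inside each of these preimages,
  and their frontier points belong to the Julia set since escaping points accumulate there.
\<close>

section \<open>Polynomial lemniscates\<close>

text \<open>The maps read before a chosen passage are arbitrary and their critical values are not
  controlled, so a splitting of the lemniscate of one word must be carried back through an unknown
  beginning. Surjectivity of clopen pieces onto the disc does this: whatever the beginning, each
  piece meets the preimages of both halves. The argument therefore works with relatively clopen
  pieces rather than connected components. Doubling of the modulus makes the preimages of the disc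
  decrease, so both halves lie in the disc and earlier cuts persist. That an exterior critical value
  disconnects the lemniscate is proved without Euler characteristics: connectedness of the set
  holding all zeros would give a root of \<open>Q\<close> on the exterior, and counting the points
  of one level excludes multiple ones. Stability turns the condition on a sequence into open
  conditions on finitely many coordinates at a time, which serves category and measure alike. The
  itinerary sets may have interior, so points of the Julia set are sought on their
  frontiers.\<close>

definition poly_lemniscate :: "complex poly \<Rightarrow> real \<Rightarrow> complex set" where
  "poly_lemniscate Q R = {z. cmod (poly Q z) \<le> R}"

text \<open>The device behind both surjectivity arguments: \<open>T\<close> comes from the image of
  an open map, compactness gives the last hypothesis, and connectedness of the target
  \<open>V\<close> does the rest. The targets are the open disc and the exterior of a closed
  disc.\<close>

lemma connected_subset_open_relatively_closed:
  assumes "connected V" "open T" "T \<inter> V \<noteq> {}"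
    and "\<And>w. w \<in> closure T \<Longrightarrow> w \<in> V \<Longrightarrow> w \<in> T"
  shows "V \<subseteq> T"
proof (rule ccontr)
  assume "\<not> V \<subseteq> T"
  moreover have "- closure T \<inter> V \<noteq> {}" using assms(4) calculation by blast
  moreover have "V \<subseteq> T \<union> - closure T" using assms(4) by blast
  moreover have "T \<inter> - closure T \<inter> V = {}" using closure_subset by blast
  ultimately show False
    using assms(1-3) closed_closure unfolding connected_def closed_def by blast
qed

lemma poly_not_constant_on_open:
  fixes Q :: "complex poly"
  assumes "degree Q > 0" "open X" "X \<noteq> {}"
  shows "\<not> poly Q constant_on X"
proof
  assume "poly Q constant_on X"
  then obtain c where c: "\<And>z. z \<in> X \<Longrightarrow> poly (Q - [:c:]) z = 0"
    by (auto simp: constant_on_def)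
  have "infinite X"
    using assms finite_imp_not_open by blast
  moreover have "Q - [:c:] \<noteq> 0"
    using assms(1) by auto
  then have "finite {z. poly (Q - [:c:]) z = 0}" by (rule poly_roots_finite)
  ultimately show False
    using c by (metis (mono_tags, lifting) finite_subset mem_Collect_eq subsetI)
qed

lemma open_poly_image:
  fixes Q :: "complex poly"
  assumes "degree Q > 0" "open X"
  shows "open (poly Q ` X)"
  by (rule open_mapping_thm2[of _ UNIV])
     (use assms poly_not_constant_on_open[OF assms(1)] in \<open>auto intro!: holomorphic_intros\<close>)

lemma eventually_norm_poly_gt:
  fixes Q :: "complex poly"
  assumes "degree Q > 0"
  shows "\<forall>\<^sub>F z in at_infinity. R < cmod (poly Q z)"
  using filterlim_at_infinity_imp_norm_at_top[OF filterlim_poly_at_infinity[OF assms]]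
  unfolding filterlim_at_top_dense by blast

lemma bounded_poly_lemniscate:
  assumes "degree Q > 0"
  shows "bounded (poly_lemniscate Q R)"
proof -
  obtain b where b: "\<And>z. cmod z \<ge> b \<Longrightarrow> R < cmod (poly Q z)"
    using eventually_norm_poly_gt[OF assms, of R] by (auto simp: eventually_at_infinity)
  then show ?thesis
    unfolding bounded_iff poly_lemniscate_def
    by (intro exI[of _ b]) (metis linorder_le_cases mem_Collect_eq not_less)
qed

lemma closed_poly_lemniscate: "closed (poly_lemniscate Q R)"
  unfolding poly_lemniscate_def
  by (intro closed_Collect_le continuous_intros)

lemma compact_poly_lemniscate: "degree Q > 0 \<Longrightarrow> compact (poly_lemniscate Q R)"
  by (simp add: compact_eq_bounded_closed bounded_poly_lemniscate closed_poly_lemniscate)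

text \<open>The image is compact, and relatively open in the open disc by the open mapping theorem.\<close>

lemma cball_subset_image_clopen_piece:
  assumes Q: "degree Q > 0" and "R > 0"
    and A: "A \<noteq> {}" "A \<subseteq> poly_lemniscate Q R" "closed A" "closed (poly_lemniscate Q R - A)"
  shows "cball 0 R \<subseteq> poly Q ` A"
proof -
  \<comment> \<open>An open set containing \<open>A\<close> and no other point of the lemniscate, so
    \<open>A\<close> and \<open>U\<close> have the same image inside the disc.\<close>
  define U where "U = - (poly_lemniscate Q R - A)"
  have U: "open U" "A \<subseteq> U" using A unfolding U_def by (blast intro: open_Compl)+
  have UA: "z \<in> A" if "z \<in> U" "cmod (poly Q z) \<le> R" for z
    using that by (auto simp: U_def poly_lemniscate_def)
  have "compact A"
    using A bounded_poly_lemniscate[OF Q] bounded_subset compact_eq_bounded_closed by blast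
  then have cA: "compact (poly Q ` A)"
    by (intro compact_continuous_image continuous_intros)
  have eq: "poly Q ` A \<inter> ball 0 R = poly Q ` U \<inter> ball 0 R"
    using U UA by (auto simp: image_iff)
  have oU: "open (poly Q ` U)" by (rule open_poly_image[OF Q U(1)])
  \<comment> \<open>A point of \<open>A\<close> may be sent to the boundary circle; openness of the
    image of \<open>U\<close> then still produces values in the open disc.\<close>
  have meets: "poly Q ` A \<inter> ball 0 R \<noteq> {}"
  proof -
    obtain a where a: "a \<in> A" using A by auto
    have w: "poly Q a \<in> cball 0 R" using a A by (auto simp: poly_lemniscate_def)
    have "poly Q a \<in> closure (ball 0 R)" using w \<open>R > 0\<close> by simp
    moreover have "poly Q a \<in> poly Q ` U" using a U by auto
    ultimately have "poly Q ` U \<inter> ball 0 R \<noteq> {}"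
      using oU open_Int_closure_eq_empty by blast
    with eq show ?thesis by simp
  qed
  have "ball 0 R \<subseteq> poly Q ` U \<inter> ball 0 R"
  proof (rule connected_subset_open_relatively_closed)
    fix w assume w: "w \<in> closure (poly Q ` U \<inter> ball 0 R)" "w \<in> ball 0 R"
    have "closure (poly Q ` U \<inter> ball 0 R) \<subseteq> poly Q ` A"
      using eq cA by (intro closure_minimal) (auto intro: compact_imp_closed)
    with w eq show "w \<in> poly Q ` U \<inter> ball 0 R" by blast
  qed (use oU meets eq in auto)
  with eq have "ball 0 R \<subseteq> poly Q ` A" by blast
  then have "closure (ball 0 R) \<subseteq> poly Q ` A"
    using cA compact_imp_closed closure_minimal by blast
  then show ?thesis using \<open>R > 0\<close> by simp
qed

section \<open>Roots of polynomials outside a connected lemniscate\<close>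

text \<open>The existence of a logarithm is an equivalence relation on \<open>E\<close> with open classes,
  because \<open>(z - a) / (z - b)\<close> lies in the right half-plane for \<open>a\<close> near \<open>b\<close>.\<close>

lemma holomorphic_log_quotient:
  fixes E S :: "complex set"
  assumes "connected E" "d > 0" and sep: "\<And>a z. a \<in> E \<Longrightarrow> z \<in> S \<Longrightarrow> d \<le> dist a z"
    and "a \<in> E" "b \<in> E"
  shows "\<exists>L. L holomorphic_on S \<and> (\<forall>z\<in>S. z - a = (z - b) * exp (L z))"
proof (rule connected_equivalence_relation[OF assms(1,4,5)])
  fix x y
  assume "\<exists>L. L holomorphic_on S \<and> (\<forall>z\<in>S. z - x = (z - y) * exp (L z))"
  then obtain L where L: "L holomorphic_on S" "\<forall>z\<in>S. z - x = (z - y) * exp (L z)" by blast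
  then show "\<exists>L. L holomorphic_on S \<and> (\<forall>z\<in>S. z - y = (z - x) * exp (L z))"
    by (intro exI[of _ "\<lambda>z. - L z"]) (auto intro!: holomorphic_intros simp: exp_minus)
next
  fix x y w
  assume "\<exists>L. L holomorphic_on S \<and> (\<forall>z\<in>S. z - x = (z - y) * exp (L z))"
    "\<exists>L. L holomorphic_on S \<and> (\<forall>z\<in>S. z - y = (z - w) * exp (L z))"
  then obtain L L' where L: "L holomorphic_on S" "\<forall>z\<in>S. z - x = (z - y) * exp (L z)"
    "L' holomorphic_on S" "\<forall>z\<in>S. z - y = (z - w) * exp (L' z)" by blast
  then show "\<exists>L. L holomorphic_on S \<and> (\<forall>z\<in>S. z - x = (z - w) * exp (L z))"
    by (intro exI[of _ "\<lambda>z. L' z + L z"]) (auto intro!: holomorphic_intros simp: exp_add)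
next
  fix x assume x: "x \<in> E"
  have "\<exists>L. L holomorphic_on S \<and> (\<forall>z\<in>S. z - x = (z - y) * exp (L z))"
    if y: "y \<in> E" "dist x y < d" for y
  proof -
    have ne: "z \<noteq> y" if "z \<in> S" for z using sep[OF y(1) that] \<open>d > 0\<close> by auto
    have pos: "Re ((z - x) / (z - y)) > 0" if z: "z \<in> S" for z
    proof -
      have "cmod (y - x) < cmod (z - y)"
        using sep[OF y(1) z] y(2) by (simp add: dist_norm norm_minus_commute)
      then have "cmod ((y - x) / (z - y)) < 1" by (simp add: norm_divide divide_less_eq)
      moreover have "(z - x) / (z - y) = 1 + (y - x) / (z - y)"
        using ne[OF z] by (simp add: field_simps)
      ultimately show ?thesis
        using abs_Re_le_cmod[of "(y - x) / (z - y)"] by simp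
    qed
    have nz: "(z - x) / (z - y) \<noteq> 0" if "z \<in> S" for z using pos[OF that] by force
    have "(\<lambda>z. Ln ((z - x) / (z - y))) holomorphic_on S"
      using ne pos by (intro holomorphic_intros) (force simp: complex_nonpos_Reals_iff)+
    moreover have "z - x = (z - y) * exp (Ln ((z - x) / (z - y)))" if "z \<in> S" for z
      using ne[OF that] nz[OF that] by (simp add: exp_Ln)
    ultimately show ?thesis by (intro exI[of _ "\<lambda>z. Ln ((z - x) / (z - y))"]) blast
  qed
  then show "\<exists>T. openin (top_of_set E) T \<and> x \<in> T \<and>
      (\<forall>y\<in>T. \<exists>L. L holomorphic_on S \<and> (\<forall>z\<in>S. z - x = (z - y) * exp (L z)))"
    using x \<open>d > 0\<close> by (intro exI[of _ "E \<inter> ball x d"]) auto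
qed

text \<open>Each linear factor \<open>z - a\<close> is traded for \<open>z - b\<close> times an
  exponential, one root at a time, which is possible because all roots lie in the connected set
  \<open>E\<close>. Dividing the exponent by the degree later gives a root of \<open>Q\<close> on
  \<open>S\<close>, although \<open>S\<close> surrounds the zeros.\<close>

lemma poly_eq_power_times_exp:
  fixes E S :: "complex set" and Q :: "complex poly"
  assumes "connected E" "d > 0" "\<And>a z. a \<in> E \<Longrightarrow> z \<in> S \<Longrightarrow> d \<le> dist a z"
    and "b \<in> E" "Q \<noteq> 0" "\<And>a. poly Q a = 0 \<Longrightarrow> a \<in> E"
  shows "\<exists>h. h holomorphic_on S \<and> (\<forall>z\<in>S. poly Q z = (z - b) ^ degree Q * exp (h z))"
  using assms(5,6)
proof (induction "degree Q" arbitrary: Q)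
  case 0
  then obtain c where "Q = [:c:]" "c \<noteq> 0" by (metis degree_eq_zeroE pCons_0_0)
  then show ?case by (intro exI[of _ "\<lambda>_. Ln c"]) simp
next
  case (Suc n)
  have "\<not> constant (poly Q)" using Suc.hyps by (simp add: constant_degree)
  then obtain a where a: "poly Q a = 0" using fundamental_theorem_of_algebra by blast
  then obtain P where P: "Q = [:- a, 1:] * P" using poly_eq_0_iff_dvd by blast
  with Suc.prems have "P \<noteq> 0" by auto
  then have deg: "degree Q = Suc (degree P)" by (simp add: P degree_mult_eq del: mult_pCons_left)
  with Suc.hyps have "n = degree P" by simp
  from Suc.hyps(1)[OF this \<open>P \<noteq> 0\<close>] Suc.prems(2) obtain h where
    h: "h holomorphic_on S" "\<forall>z\<in>S. poly P z = (z - b) ^ degree P * exp (h z)"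
    by (auto simp: P)
  have "a \<in> E" using Suc.prems(2) a by blast
  from holomorphic_log_quotient[OF assms(1,2,3) this \<open>b \<in> E\<close>] obtain L where
    L: "L holomorphic_on S" "\<forall>z\<in>S. z - a = (z - b) * exp (L z)" by blast
  have "poly Q z = (z - b) ^ degree Q * exp (L z + h z)" if "z \<in> S" for z
  proof -
    have "poly Q z = (z - a) * poly P z" by (simp add: P algebra_simps)
    with L h that show ?thesis by (simp add: deg exp_add)
  qed
  then show ?case using L h by (intro exI[of _ "\<lambda>z. L z + h z"]) (auto intro!: holomorphic_intros)
qed

text \<open>At a double root one linear factor can be cancelled without changing the set of roots,
  which then has fewer than \<open>degree P\<close> elements.\<close>

lemma no_double_root_if_card_roots:
  fixes P :: "complex poly"
  assumes "P \<noteq> 0" "card {z. poly P z = 0} \<ge> degree P" "poly P c = 0"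
  shows "poly (pderiv P) c \<noteq> 0"
proof
  assume d: "poly (pderiv P) c = 0"
  obtain S where S: "P = [:- c, 1:] * S" using assms(3) poly_eq_0_iff_dvd by blast
  have "poly S c = 0" using d unfolding S pderiv_mult by (simp add: pderiv_pCons)
  then obtain T where T: "S = [:- c, 1:] * T" using poly_eq_0_iff_dvd by blast
  have "T \<noteq> 0" "S \<noteq> 0" using S T assms(1) by auto
  then have "degree P = degree S + 1"
    using assms(1) by (simp add: S degree_mult_eq del: mult_pCons_left)
  moreover have "{z. poly P z = 0} = {z. poly S z = 0}"
    using T by (auto simp: S)
  moreover have "card {z. poly S z = 0} \<le> degree S"
    by (rule card_poly_roots_bound) fact
  ultimately show False using assms(2) by simp
qed

text \<open>If the lemniscate is connected, \<open>Q\<close> has an \<open>N\<close>-th root \<open>\<psi>\<close> (with \<open>N = degree Q\<close>)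
  on \<open>{\<bar>Q\<bar> > \<rho>}\<close>. Being open and proper, \<open>\<psi>\<close> maps onto \<open>{\<bar>w\<bar>\<^sup>N > \<rho>}\<close>, so each level
  \<open>Q = w\<^sup>N\<close> carries \<open>N\<close> distinct points.\<close>

lemma connected_lemniscate_no_exterior_critical_point:
  assumes Q: "degree Q > 0" and "R > 0" and conn: "connected (poly_lemniscate Q R)"
    and c: "cmod (poly Q c) > R"
  shows "poly (pderiv Q) c \<noteq> 0"
proof -
  define N where "N = degree Q"
  \<comment> \<open>A level strictly between \<open>R\<close> and the modulus at \<open>c\<close>:
    the gap keeps \<open>S\<close> at a positive distance from the lemniscate while \<open>c\<close>
    stays in \<open>S\<close>.\<close>
  define \<rho> where "\<rho> = (R + cmod (poly Q c)) / 2"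
  have \<rho>: "R < \<rho>" "\<rho> < cmod (poly Q c)" "\<rho> > 0" using c \<open>R > 0\<close> by (auto simp: \<rho>_def)
  define S where "S = {z. \<rho> < cmod (poly Q z)}"
  have S: "open S" "c \<in> S" unfolding S_def using \<rho>
    by (auto intro!: open_Collect_less continuous_intros)
  define E where "E = poly_lemniscate Q R"
  have "closed {z. \<rho> \<le> cmod (poly Q z)}" by (intro closed_Collect_le continuous_intros)
  moreover have "E \<inter> {z. \<rho> \<le> cmod (poly Q z)} = {}" using \<rho> by (auto simp: E_def poly_lemniscate_def)
  moreover have "compact E" unfolding E_def by (rule compact_poly_lemniscate[OF Q])
  ultimately obtain d where d: "d > 0" "\<And>a z. a \<in> E \<Longrightarrow> z \<in> {z. \<rho> \<le> cmod (poly Q z)} \<Longrightarrow> d \<le> dist a z"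
    using separate_compact_closed by metis
  have d': "d \<le> dist a z" if "a \<in> E" "z \<in> S" for a z
    using d(2)[of a z] that by (auto simp: S_def)
  have "\<not> constant (poly Q)" using Q by (simp add: constant_degree)
  then obtain b where b: "poly Q b = 0" using fundamental_theorem_of_algebra by blast
  have roots: "a \<in> E" if "poly Q a = 0" for a using that \<open>R > 0\<close> by (simp add: E_def poly_lemniscate_def)
  have "Q \<noteq> 0" using Q by auto
  have "connected E" using conn by (simp add: E_def)
  obtain h where h: "h holomorphic_on S" "\<And>z. z \<in> S \<Longrightarrow> poly Q z = (z - b) ^ N * exp (h z)"
    using poly_eq_power_times_exp[OF \<open>connected E\<close> d(1) d' roots[OF b] \<open>Q \<noteq> 0\<close> roots]
    unfolding N_def by blast
  define \<psi> where "\<psi> z = (z - b) * exp (h z / of_nat N)" for z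
  have N: "N > 0" using Q by (simp add: N_def)
  have hol: "\<psi> holomorphic_on S"
    unfolding \<psi>_def by (intro holomorphic_intros h) (use N in auto)
  have pow: "\<psi> z ^ N = poly Q z" if "z \<in> S" for z
    using N h(2)[OF that] by (simp add: \<psi>_def power_mult_distrib flip: exp_of_nat_mult)
  define r where "r = root N \<rho>"
  have rN: "cmod w ^ N > \<rho> \<longleftrightarrow> cmod w > r" for w
  proof -
    have "r \<ge> 0" "r ^ N = \<rho>" using \<rho> N by (auto simp: r_def real_root_pow_pos2)
    then show ?thesis
      by (metis N norm_ge_zero power_less_imp_less_base power_strict_mono)
  qed
  have im: "\<psi> ` S \<subseteq> - cball 0 r"
  proof (intro image_subsetI)
    fix z assume z: "z \<in> S"
    then have "cmod (\<psi> z) ^ N > \<rho>" by (simp add: pow flip: norm_power) (simp add: S_def)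
    then show "\<psi> z \<in> - cball 0 r" using rN by simp
  qed
  have op: "open (\<psi> ` S)"
  proof (rule open_mapping_thm2[OF hol S(1) S(1)])
    fix X assume X: "open X" "X \<subseteq> S" "X \<noteq> {}"
    show "\<not> \<psi> constant_on X"
    proof
      assume "\<psi> constant_on X"
      then obtain k where "\<And>z. z \<in> X \<Longrightarrow> \<psi> z = k" by (auto simp: constant_on_def)
      then have "poly Q z = k ^ N" if "z \<in> X" for z using that X pow by (metis subsetD)
      then have "poly Q constant_on X" by (auto simp: constant_on_def)
      with poly_not_constant_on_open[OF Q X(1,3)] show False by simp
    qed
  qed simp
  \<comment> \<open>Properness of \<open>\<psi>\<close>: values of \<open>Q\<close> along preimages
    of a convergent sequence are bounded, so the preimages stay in a compact lemniscate; the limit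
    is again in \<open>S\<close> because \<open>w\<close> lies strictly beyond the circle.\<close>
  have lim: "w \<in> \<psi> ` S" if w: "w \<in> closure (\<psi> ` S)" "w \<in> - cball 0 r" for w
  proof -
    obtain x where x: "\<And>n. x n \<in> \<psi> ` S" "x \<longlonglongrightarrow> w" using w(1) closure_sequential by metis
    then obtain z where z: "\<And>n. z n \<in> S" "\<And>n. x n = \<psi> (z n)"
      by (auto simp: image_iff) metis
    have "(\<lambda>n. poly Q (z n)) \<longlonglongrightarrow> w ^ N"
      using tendsto_power[OF x(2), of N] z by (simp add: pow)
    then have "Bseq (\<lambda>n. poly Q (z n))" using convergent_imp_Bseq convergentI by blast
    then obtain K where K: "\<And>n. cmod (poly Q (z n)) \<le> K" by (auto simp: Bseq_def)
    then have "range z \<subseteq> poly_lemniscate Q K" by (auto simp: poly_lemniscate_def)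
    then obtain l s where s: "strict_mono s" "(z \<circ> s) \<longlonglongrightarrow> l"
      using compact_poly_lemniscate[OF Q, of K] unfolding compact_def by blast
    have "(\<lambda>n. poly Q ((z \<circ> s) n)) \<longlonglongrightarrow> poly Q l"
      by (intro tendsto_intros s)
    moreover have "(\<lambda>n. poly Q ((z \<circ> s) n)) \<longlonglongrightarrow> w ^ N"
      using LIMSEQ_subseq_LIMSEQ[OF \<open>(\<lambda>n. poly Q (z n)) \<longlonglongrightarrow> w ^ N\<close> s(1)] by (simp add: o_def)
    ultimately have "poly Q l = w ^ N" using LIMSEQ_unique by blast
    then have l: "l \<in> S" using w(2) rN[of w] by (simp add: S_def norm_power)
    then have "isCont \<psi> l"
      using hol S(1) holomorphic_on_imp_continuous_on continuous_on_eq_continuous_at by blast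
    then have "(\<lambda>n. \<psi> ((z \<circ> s) n)) \<longlonglongrightarrow> \<psi> l"
      using s(2) isCont_tendsto_compose by blast
    moreover have "(\<lambda>n. \<psi> ((z \<circ> s) n)) \<longlonglongrightarrow> w"
      using LIMSEQ_subseq_LIMSEQ[OF x(2) s(1)] z by (simp add: o_def)
    ultimately have "\<psi> l = w" using LIMSEQ_unique by blast
    with l show ?thesis by blast
  qed
  have onto: "- cball 0 r \<subseteq> \<psi> ` S"
  proof (rule connected_subset_open_relatively_closed[OF _ op])
    show "connected (- cball (0::complex) r)"
      by (intro connected_complement_bounded_convex) auto
    show "\<psi> ` S \<inter> - cball 0 r \<noteq> {}"
      using imageI[OF S(2), of \<psi>] im unfolding disjoint_iff by blast
  qed (rule lim)
  define P where "P = Q - [:poly Q c:]"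
  have degP: "degree P = N"
    unfolding P_def N_def using degree_add_eq_left[of "- [:poly Q c:]" Q] Q
    by (simp del: minus_pCons)
  then have "P \<noteq> 0" using N by auto
  have "{w. w ^ N = poly Q c} \<subseteq> \<psi> ` {z. poly P z = 0}"
  proof
    fix w assume "w \<in> {w. w ^ N = poly Q c}"
    then have w: "w ^ N = poly Q c" by simp
    then have "cmod w ^ N > \<rho>" using \<rho> by (simp flip: norm_power)
    then have "w \<in> - cball 0 r" using rN by simp
    then obtain z where z: "z \<in> S" "w = \<psi> z" using onto by blast
    then have "poly P z = 0" using pow w by (simp add: P_def)
    with z show "w \<in> \<psi> ` {z. poly P z = 0}" by blast
  qed
  then have "card {w. w ^ N = poly Q c} \<le> card {z. poly P z = 0}"
    by (rule surj_card_le[OF poly_roots_finite[OF \<open>P \<noteq> 0\<close>]])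
  moreover have "card {w. w ^ N = poly Q c} = N"
    using N \<rho> by (intro card_nth_roots) auto
  ultimately have "poly (pderiv P) c \<noteq> 0"
    by (intro no_double_root_if_card_roots) (auto simp: degP \<open>P \<noteq> 0\<close>, simp add: P_def)
  then show ?thesis by (simp add: P_def pderiv_diff pderiv_pCons)
qed

section \<open>Topology of the Riemann sphere\<close>

lemma inner_stereo_bounds: "\<bar>stereo p \<bullet> stereo q\<bar> \<le> 1"
  using Cauchy_Schwarz_ineq2[of "stereo p" "stereo q"] by simp

lemma inner_stereo_chord: "stereo p \<bullet> stereo q = 1 - (dist (stereo p) (stereo q))\<^sup>2 / 2"
proof -
  have "stereo x \<bullet> stereo x = 1" for x by (simp add: dot_square_norm)
  then show ?thesis
    by (simp add: dist_norm power2_norm_eq_inner inner_diff inner_commute field_simps)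
qed

text \<open>Great-circle distance and chord determine each other through
  \<open>chord^2 = 2 - 2 cos dist\<close>. Convergence on the sphere can thus be checked in the
  ambient Euclidean space.\<close>

lemma tendsto_stereo_iff:
  "(f \<longlongrightarrow> l) F \<longleftrightarrow> ((\<lambda>x. stereo (f x)) \<longlongrightarrow> stereo l) F"
proof
  assume "(f \<longlongrightarrow> l) F"
  then have "((\<lambda>x. dist (f x) l) \<longlongrightarrow> 0) F"
    by (rule tendsto_dist_iff[THEN iffD1])
  from isCont_tendsto_compose[OF isCont_cos this]
  have "((\<lambda>x. sqrt (2 - 2 * cos (dist (f x) l))) \<longlongrightarrow> sqrt (2 - 2 * cos 0)) F"
    by (intro tendsto_intros)
  moreover have "sqrt (2 - 2 * cos (dist p q)) = dist (stereo p) (stereo q)" for p q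
    using inner_stereo_bounds[of p q]
    by (simp add: dist_riemann_sphere_def cos_arccos_abs inner_stereo_chord)
  ultimately show "((\<lambda>x. stereo (f x)) \<longlongrightarrow> stereo l) F"
    by (subst tendsto_dist_iff) simp
next
  assume "((\<lambda>x. stereo (f x)) \<longlongrightarrow> stereo l) F"
  then have "((\<lambda>x. stereo (f x) \<bullet> stereo l) \<longlongrightarrow> stereo l \<bullet> stereo l) F"
    by (intro tendsto_intros)
  then have "((\<lambda>x. stereo (f x) \<bullet> stereo l) \<longlongrightarrow> 1) F"
    by (simp add: dot_square_norm)
  moreover have "\<forall>\<^sub>F x in F. stereo (f x) \<bullet> stereo l \<in> {-1..1}"
    using inner_stereo_bounds by (intro always_eventually allI) (metis abs_le_iff atLeastAtMost_iff minus_le_iff)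
  ultimately have "((\<lambda>x. arccos (stereo (f x) \<bullet> stereo l)) \<longlongrightarrow> arccos 1) F"
    by (intro continuous_on_tendsto_compose[OF continuous_on_arccos']) auto
  then show "(f \<longlongrightarrow> l) F"
    by (subst tendsto_dist_iff) (simp add: dist_riemann_sphere_def)
qed

text \<open>Stereographic projection from the pole \<open>(0, 1)\<close>. Only its values on the
  unit sphere are meaningful.\<close>

definition sphere_chart_inv :: "complex \<times> real \<Rightarrow> riemann_sphere" where
  "sphere_chart_inv v = (if snd v = 1 then Infty else Fin (fst v / of_real (1 - snd v)))"

lemma one_minus_snd_stereo: "1 - snd (stereo (Fin z)) = 2 / (1 + (cmod z)\<^sup>2)"
proof -
  have "1 + (cmod z)\<^sup>2 > 0" by (simp add: add_pos_nonneg)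
  then show ?thesis by (simp add: stereo_def field_simps)
qed

lemma sphere_chart_inv_stereo: "sphere_chart_inv (stereo p) = p"
proof (cases p)
  case (Fin z)
  have pos: "1 + (cmod z)\<^sup>2 > 0" by (simp add: add_pos_nonneg)
  then have ne: "complex_of_real (2 / (1 + (cmod z)\<^sup>2)) \<noteq> 0"
    by (simp only: of_real_eq_0_iff) auto
  have "snd (stereo (Fin z)) \<noteq> 1"
    using one_minus_snd_stereo[of z] pos by auto
  moreover have "fst (stereo (Fin z)) = of_real (2 / (1 + (cmod z)\<^sup>2)) * z"
    by (simp add: stereo_def)
  ultimately show ?thesis
    unfolding sphere_chart_inv_def one_minus_snd_stereo Fin
    using ne by simp
qed (simp add: sphere_chart_inv_def stereo_def)

lemma stereo_surj:
  assumes "norm v = 1"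
  obtains p where "stereo p = v"
proof (cases "snd v = 1")
  case True
  with assms have "fst v = 0" by (simp add: norm_prod_def)
  with True have "stereo Infty = v" by (simp add: stereo_def prod_eq_iff)
  with that show thesis .
next
  case False
  obtain u t where v: "v = (u, t)" by (cases v)
  have n: "(cmod u)\<^sup>2 = (1 - t) * (1 + t)"
    using assms by (simp add: v norm_prod_def algebra_simps power2_eq_square)
  have "\<bar>t\<bar> \<le> 1" using norm_snd_le[of t u] assms v by simp
  with False v have t: "1 - t > 0" by auto
  define z where "z = u / of_real (1 - t)"
  have m: "(cmod z)\<^sup>2 = (1 + t) / (1 - t)"
    using t n by (simp add: z_def norm_divide power_divide power2_eq_square del: of_real_diff)
  have "1 + (cmod z)\<^sup>2 = 2 / (1 - t)" using t by (simp add: m field_simps)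
  then have a: "2 / (1 + (cmod z)\<^sup>2) = 1 - t" using t by simp
  have "snd (stereo (Fin z)) = t" using one_minus_snd_stereo[of z] a by simp
  moreover have "fst (stereo (Fin z)) = of_real (2 / (1 + (cmod z)\<^sup>2)) * z"
    by (simp add: stereo_def)
  then have "fst (stereo (Fin z)) = u"
    unfolding a using t by (simp add: z_def del: of_real_diff)
  ultimately have "stereo (Fin z) = v" by (simp add: prod_eq_iff v)
  with that show thesis .
qed

lemma compact_UNIV_riemann_sphere: "compact (UNIV :: riemann_sphere set)"
proof -
  have st: "stereo (sphere_chart_inv v) = v" if "norm v = 1" for v
    using stereo_surj[OF that] sphere_chart_inv_stereo by metis
  have "continuous_on (sphere 0 1) sphere_chart_inv"
    unfolding continuous_on_def
  proof (intro ballI)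
    fix v :: "complex \<times> real" assume v: "v \<in> sphere 0 1"
    have "((\<lambda>x. stereo (sphere_chart_inv x)) \<longlongrightarrow> v) (at v within sphere 0 1)"
      by (rule Lim_transform_eventually[OF tendsto_ident_at])
         (auto simp: eventually_at_filter st)
    then show "(sphere_chart_inv \<longlongrightarrow> sphere_chart_inv v) (at v within sphere 0 1)"
      using v st by (subst tendsto_stereo_iff) simp
  qed
  then have "compact (sphere_chart_inv ` sphere 0 1)"
    by (intro compact_continuous_image) auto
  moreover have "p \<in> sphere_chart_inv ` sphere 0 1" for p
    by (rule image_eqI[of _ _ "stereo p"]) (simp_all add: sphere_chart_inv_stereo)
  ultimately show ?thesis by (metis UNIV_eq_I)
qed

lemma continuous_on_stereo: "continuous_on A stereo"
  unfolding continuous_on_def using tendsto_stereo_iff[of "\<lambda>x. x"] tendsto_ident_at by blast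

lemma continuous_on_Fin: "continuous_on A Fin"
  unfolding continuous_on_def
proof (intro ballI)
  fix z assume "z \<in> A"
  have "1 + (cmod z)\<^sup>2 \<noteq> 0" "(cmod z)\<^sup>2 + 1 \<noteq> 0" by (smt (verit) zero_le_power2)+
  then have "((\<lambda>w. stereo (Fin w)) \<longlongrightarrow> stereo (Fin z)) (at z within A)"
    unfolding stereo_def riemann_sphere.case by (intro tendsto_intros)
  then show "(Fin \<longlongrightarrow> Fin z) (at z within A)"
    by (subst tendsto_stereo_iff)
qed

definition to_complex :: "riemann_sphere \<Rightarrow> complex" where
  "to_complex p = (case p of Fin z \<Rightarrow> z | Infty \<Rightarrow> 0)"

lemma to_complex_Fin [simp]: "to_complex (Fin z) = z"
  by (simp add: to_complex_def)

lemma continuous_on_to_complex: "continuous_on (- {Infty}) to_complex"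
proof -
  have ne: "snd (stereo p) \<noteq> 1" if p: "p \<in> - {Infty}" for p
  proof
    assume "snd (stereo p) = 1"
    then have "sphere_chart_inv (stereo p) = Infty" by (simp add: sphere_chart_inv_def)
    with p sphere_chart_inv_stereo show False by simp
  qed
  have eq: "to_complex p = fst (stereo p) / of_real (1 - snd (stereo p))" if p: "p \<in> - {Infty}" for p
    using sphere_chart_inv_stereo[of p] ne[OF p] unfolding sphere_chart_inv_def
    by (metis to_complex_Fin)
  have "continuous_on (- {Infty}) (\<lambda>p. fst (stereo p) / of_real (1 - snd (stereo p)))"
    using ne by (intro continuous_intros continuous_on_stereo) auto
  then show ?thesis
    by (rule continuous_on_eq) (simp add: eq)
qed

lemma open_Fin_image:
  assumes "open S"
  shows "open (Fin ` S)"
proof -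
  have "Fin ` S = to_complex -` S \<inter> - {Infty}"
  proof (intro set_eqI iffI)
    fix p assume "p \<in> to_complex -` S \<inter> - {Infty}"
    then show "p \<in> Fin ` S" by (cases p) auto
  qed auto
  then show ?thesis
    using continuous_open_vimage continuous_on_open_vimage[of "- {Infty}" to_complex]
      continuous_on_to_complex assms by (metis Compl_eq_Diff_UNIV Int_commute open_UNIV open_delete)
qed

section \<open>Spherical distance to infinity\<close>

text \<open>The distance from \<open>Infty\<close> of any point of modulus \<open>r\<close>, read
  off from the last coordinate of \<open>stereo\<close>. Its strict monotonicity makes exteriors of
  discs the same as balls around \<open>Infty\<close>.\<close>

definition arc_to_infinity :: "real \<Rightarrow> real" where
  "arc_to_infinity r = arccos (1 - 2 / (1 + r\<^sup>2))"

lemma one_plus_square_ge_1: "1 \<le> 1 + (r::real)\<^sup>2"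
  by simp

lemma arc_to_infinity_argument_bounds: "\<bar>1 - 2 / (1 + (r::real)\<^sup>2)\<bar> \<le> 1"
proof -
  have "0 < 2 / q" "2 / q \<le> 2" if "1 \<le> q" for q :: real
    using that by (auto simp: divide_le_eq)
  from this[OF one_plus_square_ge_1[of r]] show ?thesis by linarith
qed

lemma dist_Fin_Infty: "dist (Fin z) Infty = arc_to_infinity (cmod z)"
proof -
  have "snd (stereo (Fin z)) = 1 - 2 / (1 + (cmod z)\<^sup>2)" using one_minus_snd_stereo[of z] by simp
  then have "stereo (Fin z) \<bullet> stereo Infty = 1 - 2 / (1 + (cmod z)\<^sup>2)"
    by (simp add: stereo_def inner_prod_def)
  then show ?thesis unfolding dist_riemann_sphere_def arc_to_infinity_def by simp
qed

lemma arc_to_infinity_strict_antimono: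
  assumes "0 \<le> r" "r < s"
  shows "arc_to_infinity s < arc_to_infinity r"
proof -
  have "r\<^sup>2 < s\<^sup>2" using assms by (simp add: power_strict_mono)
  then have "2 / (1 + s\<^sup>2) < 2 / (1 + r\<^sup>2)"
    using one_plus_square_ge_1[of r] by (intro divide_strict_left_mono mult_pos_pos) linarith+
  then show ?thesis
    using arc_to_infinity_argument_bounds[of r] arc_to_infinity_argument_bounds[of s]
    unfolding arc_to_infinity_def by (subst arccos_less_mono) auto
qed

lemma arc_to_infinity_antimono:
  "0 \<le> r \<Longrightarrow> r \<le> s \<Longrightarrow> arc_to_infinity s \<le> arc_to_infinity r"
  using arc_to_infinity_strict_antimono[of r s] by (cases "r = s") auto

lemma arc_to_infinity_tendsto_0: "(arc_to_infinity \<longlongrightarrow> 0) at_top"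
proof -
  have "((\<lambda>r::real. 1 - 2 / (1 + r\<^sup>2)) \<longlongrightarrow> 1) at_top" by real_asymp
  moreover have "\<forall>\<^sub>F r in at_top. 1 - 2 / (1 + r\<^sup>2) \<in> {-1..1::real}"
    using arc_to_infinity_argument_bounds by (intro always_eventually allI) (auto simp: abs_le_iff)
  ultimately have "((\<lambda>r::real. arccos (1 - 2 / (1 + r\<^sup>2))) \<longlongrightarrow> arccos 1) at_top"
    by (intro continuous_on_tendsto_compose[OF continuous_on_arccos']) auto
  then show ?thesis unfolding arc_to_infinity_def[abs_def] by simp
qed

lemma dist_Fin_Infty_less_iff:
  assumes "0 \<le> r"
  shows "dist (Fin z) Infty < arc_to_infinity r \<longleftrightarrow> r < cmod z"
proof (cases "r < cmod z")
  case True
  with assms arc_to_infinity_strict_antimono show ?thesis by (simp add: dist_Fin_Infty)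
next
  case False
  then have "arc_to_infinity r \<le> arc_to_infinity (cmod z)" by (intro arc_to_infinity_antimono) auto
  with False show ?thesis by (simp add: dist_Fin_Infty)
qed

lemma arc_to_infinity_pos:
  assumes "0 \<le> r"
  shows "0 < arc_to_infinity r"
proof -
  have "dist (Fin (of_real (r + 1))) Infty < arc_to_infinity r"
    using assms by (subst dist_Fin_Infty_less_iff) (auto simp del: of_real_add)
  then show ?thesis by (rule le_less_trans[OF zero_le_dist])
qed

lemma open_near_Infty:
  assumes "0 \<le> r"
  shows "open (insert Infty (Fin ` {z. r < cmod z}))"
proof -
  have "insert Infty (Fin ` {z. r < cmod z}) = ball Infty (arc_to_infinity r)"
  proof (intro set_eqI)
    fix p show "p \<in> insert Infty (Fin ` {z. r < cmod z}) \<longleftrightarrow> p \<in> ball Infty (arc_to_infinity r)"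
      using assms dist_Fin_Infty_less_iff[OF assms] arc_to_infinity_pos[OF assms]
      by (cases p) (auto simp: dist_commute)
  qed
  then show ?thesis by simp
qed

lemma continuous_on_poly_ext:
  assumes "degree p > 0"
  shows "continuous_on A (poly_ext p)"
proof -
  have "isCont (poly_ext p) x" for x
  proof (cases x)
    case (Fin z)
    have "continuous_on (Fin ` UNIV) (\<lambda>x. Fin (poly p (to_complex x)))"
      by (rule continuous_on_compose2[OF continuous_on_Fin[of UNIV]])
         (auto intro!: continuous_intros continuous_on_subset[OF continuous_on_to_complex])
    then have "continuous_on (Fin ` UNIV) (poly_ext p)"
      by (rule continuous_on_eq) (auto simp: poly_ext_def)
    moreover have "open (Fin ` UNIV)" by (rule open_Fin_image) simp
    ultimately show ?thesis by (simp add: Fin continuous_on_eq_continuous_at)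
  next
    case Infty
    have "\<forall>\<^sub>F y in at Infty. dist (poly_ext p y) Infty < e" if e: "e > 0" for e
    proof -
      have "\<forall>\<^sub>F r in at_top. arc_to_infinity r < e"
        using arc_to_infinity_tendsto_0 e by (rule order_tendstoD)
      then obtain s where s: "s \<ge> 0" "arc_to_infinity s < e"
        by (metis eventually_at_top_linorder linorder_linear)
      obtain b where b: "\<And>z. cmod z \<ge> b \<Longrightarrow> s < cmod (poly p z)"
        using eventually_norm_poly_gt[OF assms, of s] by (auto simp: eventually_at_infinity)
      have "\<forall>\<^sub>F y in at Infty. y \<in> insert Infty (Fin ` {z. max b 0 < cmod z})"
        by (intro eventually_at_in_open' open_near_Infty) auto
      then show ?thesis
      proof eventually_elim
        case (elim y)
        show ?case
        proof (cases y)
          case (Fin z)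
          with elim have "s < cmod (poly p z)" by (intro b) auto
          then have "dist (Fin (poly p z)) Infty < arc_to_infinity s"
            by (simp add: dist_Fin_Infty_less_iff[OF s(1)])
          with s Fin show ?thesis by (simp add: poly_ext_def)
        qed (simp add: e poly_ext_def)
      qed
    qed
    then show ?thesis unfolding isCont_def tendsto_iff Infty by (simp add: poly_ext_def)
  qed
  then show ?thesis by (simp add: continuous_at_imp_continuous_on)
qed

section \<open>Polynomial maps and their supports\<close>

definition poly_of :: "polymap \<Rightarrow> complex poly" where
  "poly_of f = (SOME p. as_map f = poly_ext p \<and> 2 \<le> degree p)"

lemma as_map_eq_poly_ext: "as_map f = poly_ext (poly_of f)"
  and degree_poly_of: "2 \<le> degree (poly_of f)"
proof -
  have "\<exists>p. as_map f = poly_ext p \<and> 2 \<le> degree p" using as_map[of f] by blast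
  then have "as_map f = poly_ext (poly_of f) \<and> 2 \<le> degree (poly_of f)"
    unfolding poly_of_def by (rule someI_ex)
  then show "as_map f = poly_ext (poly_of f)" "2 \<le> degree (poly_of f)" by auto
qed

lemma continuous_on_as_map: "continuous_on A (as_map f)"
  unfolding as_map_eq_poly_ext
  by (rule continuous_on_poly_ext) (use degree_poly_of[of f] in auto)

lemma dist_as_map_le: "dist (as_map f x) (as_map g x) \<le> dist f g"
  unfolding dist_polymap_def
  by (rule cSUP_upper) (auto intro!: bdd_aboveI2[of _ _ pi] dist_riemann_sphere_le_pi)

lemma dist_polymap_leI:
  "(\<And>x. dist (as_map f x) (as_map g x) \<le> e) \<Longrightarrow> dist f g \<le> e"
  unfolding dist_polymap_def by (rule cSUP_least) auto

lemma uniformly_continuous_as_map: "uniformly_continuous_on UNIV (as_map f)"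
  by (intro compact_uniformly_continuous continuous_on_as_map compact_UNIV_riemann_sphere)

text \<open>For every \<open>e\<close>, a polynomial map is determined up to \<open>4e\<close> by a mesh size on which it
  oscillates by less than \<open>e\<close> and by its values, rounded to a finite \<open>e\<close>-net, on a net of that mesh;
  there are only countably many such data.\<close>

lemma polymap_separable:
  obtains D :: "polymap set" where "countable D" "\<And>f e. 0 < e \<Longrightarrow> \<exists>g\<in>D. dist g f < e"
proof -
  define u where "u k = 1 / real (Suc k)" for k
  have u: "u k > 0" for k by (simp add: u_def)
  have "\<exists>N::riemann_sphere set. finite N \<and> (\<forall>x. \<exists>y\<in>N. dist x y < u k)" for k
  proof -
    obtain N where "finite N" "(UNIV::riemann_sphere set) \<subseteq> (\<Union>x\<in>N. ball x (u k))"
      using compactE_image[OF compact_UNIV_riemann_sphere, of UNIV "\<lambda>x. ball x (u k)"] u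
      by (metis UNIV_I UN_I centre_in_ball open_ball subsetI top_greatest)
    then show ?thesis by (intro exI[of _ N]) (auto simp: dist_commute subset_eq)
  qed
  then have "\<exists>N. \<forall>k. finite (N k) \<and> (\<forall>x::riemann_sphere. \<exists>y\<in>N k. dist x y < u k)"
    by (intro choice allI)
  then obtain N where N: "\<And>k. finite (N k)" "\<And>k (x::riemann_sphere). \<exists>y\<in>N k. dist x y < u k" by blast
  define keys where "keys k = Sigma UNIV (\<lambda>m. N m \<rightarrow>\<^sub>E N k)" for k
  define R where "R k key f \<longleftrightarrow> (\<forall>x y. dist x y < u (fst key) \<longrightarrow> dist (as_map f x) (as_map f y) < u k)
    \<and> (\<forall>y\<in>N (fst key). dist (as_map f y) (snd key y) < u k)" for k key f
  define rep where "rep k key = (SOME f. R k key f)" for k key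
  have ck: "countable (keys k)" for k
    unfolding keys_def by (rule countable_SIGMA) (auto intro!: countable_finite finite_PiE N)
  have ex: "\<exists>key\<in>keys k. R k key f" for k f
  proof -
    obtain d where d: "d > 0" "\<And>x y. dist x y < d \<Longrightarrow> dist (as_map f x) (as_map f y) < u k"
      using uniformly_continuous_as_map[of f] u[of k] unfolding uniformly_continuous_on_def
      by (metis UNIV_I dist_commute)
    obtain m where m: "u m < d" using d(1) reals_Archimedean unfolding u_def by (metis inverse_eq_divide)
    obtain r where r: "\<And>x. r x \<in> N k" "\<And>x. dist x (r x) < u k" using N(2) by metis
    have "(m, restrict (\<lambda>y. r (as_map f y)) (N m)) \<in> keys k"
      using r by (auto simp: keys_def)
    moreover have "R k (m, restrict (\<lambda>y. r (as_map f y)) (N m)) f"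
      unfolding R_def using d m r by (auto intro: less_trans)
    ultimately show ?thesis by blast
  qed
  have close: "dist f g \<le> 4 * u k" if "R k key f" "R k key g" for k key f g
  proof (rule dist_polymap_leI)
    fix x
    obtain y where y: "y \<in> N (fst key)" "dist x y < u (fst key)" using N(2) by blast
    have "dist (as_map f x) (as_map f y) < u k" "dist (as_map g x) (as_map g y) < u k"
      "dist (as_map f y) (snd key y) < u k" "dist (as_map g y) (snd key y) < u k"
      using that y unfolding R_def by auto
    then show "dist (as_map f x) (as_map g x) \<le> 4 * u k"
      using dist_triangle[of "as_map f x" "as_map g x" "as_map f y"]
        dist_triangle[of "as_map f y" "as_map g x" "snd key y"]
        dist_triangle[of "snd key y" "as_map g x" "as_map g y"]
      by (simp add: dist_commute)
  qed
  define D where "D = (\<Union>k. rep k ` keys k)"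
  show thesis
  proof (rule that)
    show "countable D" unfolding D_def by (intro countable_UN countable_image ck) auto
    fix f and e :: real assume "0 < e"
    then obtain k where k: "4 * u k < e"
      using reals_Archimedean[of "e / 4"] unfolding u_def by (auto simp: field_simps)
    obtain key where key: "key \<in> keys k" "R k key f" using ex by blast
    then have "R k key (rep k key)" unfolding rep_def by (metis someI)
    with close key have "dist (rep k key) f \<le> 4 * u k" by blast
    with k key show "\<exists>g\<in>D. dist g f < e" unfolding D_def by force
  qed
qed

text \<open>Every point off the support lies in a null ball whose centre is in a countable dense set
  and whose radius is some \<open>1 / Suc n\<close>; countably many null balls form a null set. This
  is the purpose of separability.\<close>

lemma AE_in_measure_support:
  fixes \<tau> :: "polymap measure"
  assumes "borel_probability \<tau>"
  shows "AE f in \<tau>. f \<in> measure_support \<tau>"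
proof -
  obtain D :: "polymap set" where D: "countable D" "\<And>f e. 0 < e \<Longrightarrow> \<exists>g\<in>D. dist g f < e"
    by (rule polymap_separable) blast
  have sets: "sets \<tau> = sets borel" using assms by (simp add: borel_probability_def)
  define I where "I = {(g, n::nat). g \<in> D \<and> emeasure \<tau> (ball g (1 / real (Suc n))) = 0}"
  have "countable I"
    by (rule countable_subset[of _ "D \<times> UNIV"]) (use D in \<open>auto simp: I_def\<close>)
  then have "(\<Union>(g, n)\<in>I. ball g (1 / real (Suc n))) \<in> null_sets \<tau>"
    by (intro null_sets_UN') (auto simp: I_def null_sets_def sets)
  then have "AE f in \<tau>. f \<notin> (\<Union>(g, n)\<in>I. ball g (1 / real (Suc n)))" by (rule AE_not_in)
  then show ?thesis
  proof eventually_elim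
    case (elim f)
    show ?case
    proof (rule ccontr)
      assume "f \<notin> measure_support \<tau>"
      then obtain V where V: "open V" "f \<in> V" "emeasure \<tau> V = 0"
        by (auto simp: measure_support_def not_gr_zero)
      then obtain e where e: "e > 0" "ball f e \<subseteq> V" by (meson openE)
      obtain n where n: "1 / real (Suc n) < e / 2"
        using e reals_Archimedean[of "e / 2"] by (auto simp: inverse_eq_divide)
      obtain g where g: "g \<in> D" "dist g f < 1 / real (Suc n)"
        using D(2)[of "1 / real (Suc n)" f] by auto
      have "ball g (1 / real (Suc n)) \<subseteq> V"
      proof
        fix x assume "x \<in> ball g (1 / real (Suc n))"
        then have "dist f x < e"
          using g n dist_triangle[of f x g] by (simp add: dist_commute)
        with e show "x \<in> V" by auto
      qed
      then have "emeasure \<tau> (ball g (1 / real (Suc n))) = 0"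
        using emeasure_mono[of _ V \<tau>] V sets by (metis le_zero_eq borel_open)
      with g have "(g, n) \<in> I" by (simp add: I_def)
      with g elim show False by force
    qed
  qed
qed

text \<open>Let \<open>F k\<close> be the event that none of the adjacent blocks starting at
  \<open>k\<close>, \<open>k + N\<close>, \<open>k + 2 * N\<close>, ... is a hit. Splitting off the
  first block shows that the probability of \<open>F 0\<close> equals itself times a factor below 1,
  so it vanishes; dropping the first \<open>k\<close> coordinates carries this to
  \<open>F k\<close>.\<close>

lemma (in sequence_space) AE_infinitely_often_block:
  assumes X: "\<And>i. i < N \<Longrightarrow> X i \<in> sets M" "\<And>i. i < N \<Longrightarrow> emeasure M (X i) > 0"
  shows "AE \<omega> in S. \<exists>\<^sub>\<infinity>m. \<forall>i<N. \<omega> (m + i) \<in> X i"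
proof -
  define H where "H m = {\<omega> \<in> space S. \<forall>i<N. \<omega> (m + i) \<in> X i}" for m
  have H: "H m \<in> sets S" for m
    unfolding H_def using X by measurable
  define F where "F k = (\<Inter>j. space S - H (k + j * N))" for k
  have F: "F k \<in> sets S" for k unfolding F_def using H by blast
  \<comment> \<open>Cutting sequences after \<open>n\<close> coordinates identifies \<open>S\<close>
    with the product of two copies of itself, which expresses independence of beginning and
    tail.\<close>
  have shift: "emeasure S A = emeasure S B * emeasure S C"
    if "A \<in> sets S" "B \<in> sets S" "C \<in> sets S"
      "\<And>\<omega> \<omega>'. \<omega> \<in> space S \<Longrightarrow> \<omega>' \<in> space S \<Longrightarrow> comb_seq n \<omega> \<omega>' \<in> A \<longleftrightarrow> \<omega> \<in> B \<and> \<omega>' \<in> C"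
    for A B C n
  proof -
    have "emeasure S A = emeasure (distr (S \<Otimes>\<^sub>M S) S (\<lambda>(\<omega>, \<omega>'). comb_seq n \<omega> \<omega>')) A"
      by (simp add: PiM_comb_seq)
    also have "\<dots> = emeasure (S \<Otimes>\<^sub>M S) ((\<lambda>(\<omega>, \<omega>'). comb_seq n \<omega> \<omega>') -` A \<inter> space (S \<Otimes>\<^sub>M S))"
      by (rule emeasure_distr[OF measurable_comb_seq that(1)])
    also have "(\<lambda>(\<omega>, \<omega>'). comb_seq n \<omega> \<omega>') -` A \<inter> space (S \<Otimes>\<^sub>M S) = B \<times> C"
      using that sets.sets_into_space[OF that(2)] sets.sets_into_space[OF that(3)]
      by (auto simp: space_pair_measure subset_iff)
    also have "emeasure (S \<Otimes>\<^sub>M S) (B \<times> C) = emeasure S B * emeasure S C"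
      by (rule P.emeasure_pair_measure_Times[OF that(2,3)])
    finally show ?thesis .
  qed
  have comb_space: "comb_seq n \<omega> \<omega>' \<in> space S" if "\<omega> \<in> space S" "\<omega>' \<in> space S" for n \<omega> \<omega>'
    using that by (auto simp: space_PiM PiE_iff split: split_comb_seq)
  have comb_add: "comb_seq n \<omega> \<omega>' (n + i) = \<omega>' i" for n \<omega> \<omega>' i
    by (simp add: comb_seq_def)
  have F0_eq: "emeasure S (F 0) = emeasure S (space S - H 0) * emeasure S (F 0)"
  proof (rule shift[of _ _ _ N])
    fix \<omega> \<omega>' assume w: "\<omega> \<in> space S" "\<omega>' \<in> space S"
    have "comb_seq N \<omega> \<omega>' \<in> H 0 \<longleftrightarrow> \<omega> \<in> H 0"
      using w comb_space by (auto simp: H_def comb_seq_less)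
    moreover have "comb_seq N \<omega> \<omega>' \<in> H (0 + Suc j * N) \<longleftrightarrow> \<omega>' \<in> H (0 + j * N)" for j
      using w comb_space comb_add[of N \<omega> \<omega>' "j * N + _"] by (simp add: H_def add.assoc)
    moreover have "\<eta> \<in> F 0 \<longleftrightarrow> \<eta> \<notin> H 0 \<and> (\<forall>j. \<eta> \<notin> H (0 + Suc j * N))" if \<eta>: "\<eta> \<in> space S" for \<eta>
    proof -
      have "\<eta> \<in> F 0 \<longleftrightarrow> (\<forall>j. \<eta> \<notin> H (0 + j * N))" unfolding F_def using \<eta> by auto
      also have "\<dots> \<longleftrightarrow> \<eta> \<notin> H (0 + 0 * N) \<and> (\<forall>j. \<eta> \<notin> H (0 + Suc j * N))"
        by (metis not0_implies_Suc)
      finally show ?thesis by simp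
    qed
    moreover have "\<eta> \<in> F 0 \<longleftrightarrow> (\<forall>j. \<eta> \<notin> H (0 + j * N))" if "\<eta> \<in> space S" for \<eta>
      unfolding F_def using that by auto
    ultimately show "comb_seq N \<omega> \<omega>' \<in> F 0 \<longleftrightarrow> \<omega> \<in> space S - H 0 \<and> \<omega>' \<in> F 0"
      using w comb_space by simp
  qed (use F H in auto)
  have "emeasure S (H 0) = (\<Prod>i<N. emeasure M (X i))"
    using emeasure_PiM_Collect[of "{..<N}" X] X by (simp add: H_def Ball_def)
  moreover have "0 < (\<Prod>i<n. emeasure M (X i))" if "n \<le> N" for n
    using that by (induction n) (auto simp: ennreal_zero_less_mult_iff X)
  ultimately have "emeasure S (H 0) > 0" by simp
  then have "measure S (H 0) > 0" by (simp add: P.emeasure_eq_measure)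
  then have "measure S (space S - H 0) < 1" using H by (simp add: P.prob_compl)
  with F0_eq have F0: "measure S (F 0) = 0"
    by (simp add: P.emeasure_eq_measure flip: ennreal_mult)
  have "emeasure S (F k) = 0" for k
  proof -
    have "emeasure S (F k) = emeasure S (space S) * emeasure S (F 0)"
    proof (rule shift[of _ _ _ k])
      fix \<omega> \<omega>' assume w: "\<omega> \<in> space S" "\<omega>' \<in> space S"
      have "comb_seq k \<omega> \<omega>' \<in> H (k + j * N) \<longleftrightarrow> \<omega>' \<in> H (0 + j * N)" for j
        using w comb_space comb_add[of k \<omega> \<omega>' "j * N + _"] by (simp add: H_def add.assoc)
      then show "comb_seq k \<omega> \<omega>' \<in> F k \<longleftrightarrow> \<omega> \<in> space S \<and> \<omega>' \<in> F 0"
        using w comb_space unfolding F_def by auto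
    qed (use F in auto)
    then show ?thesis by (simp add: F0 P.emeasure_eq_measure)
  qed
  then have "AE \<omega> in S. \<forall>k. \<omega> \<notin> F k"
    unfolding AE_all_countable using F by (auto intro!: AE_not_in simp: null_sets_def)
  then show ?thesis
  proof (rule AE_mp, intro AE_I2 impI)
    fix \<omega> assume w: "\<omega> \<in> space S" "\<forall>k. \<omega> \<notin> F k"
    show "\<exists>\<^sub>\<infinity>m. \<forall>i<N. \<omega> (m + i) \<in> X i"
      unfolding INFM_nat_le
    proof
      fix k
      obtain j where "\<omega> \<in> H (k + j * N)" using w unfolding F_def by blast
      then show "\<exists>n\<ge>k. \<forall>i<N. \<omega> (n + i) \<in> X i"
        unfolding H_def by (intro exI[of _ "k + j * N"]) auto
    qed
  qed
qed

section \<open>Escaping orbits\<close>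

lemma poly_ext_Fin [simp]: "poly_ext p (Fin z) = Fin (poly p z)"
  and poly_ext_Infty [simp]: "poly_ext p Infty = Infty"
  by (simp_all add: poly_ext_def)

text \<open>On the exterior of the disc, \<open>z / q z\<close> becomes holomorphic at infinity in the coordinate
  \<open>w = 1 / z\<close>, so the maximum principle applies.\<close>

lemma exterior_maximum_principle:
  fixes q :: "complex poly"
  assumes deg: "2 \<le> degree q" and "R > 0"
    and nz: "\<And>z. R \<le> cmod z \<Longrightarrow> poly q z \<noteq> 0"
    and bd: "\<And>z. cmod z = R \<Longrightarrow> 2 * cmod z \<le> cmod (poly q z)"
    and z: "R \<le> cmod z"
  shows "2 * cmod z \<le> cmod (poly q z)"
proof -
  \<comment> \<open>For nonzero \<open>w\<close> this is \<open>z / q z\<close> at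
    \<open>z = 1 / w\<close>. The reflected polynomial removes the singularity at 0, where the
    denominator becomes the leading coefficient of \<open>q\<close>.\<close>
  define h where "h w = w ^ (degree q - 1) / poly (reflect_poly q) w" for w
  have "q \<noteq> 0" using deg by auto
  have refl: "poly (reflect_poly q) w = w ^ degree q * poly q (1 / w)" if "w \<noteq> 0" for w
    using that by (simp add: poly_reflect_poly_nz inverse_eq_divide)
  have inv: "R \<le> cmod (1 / w)" if "w \<noteq> 0" "cmod w \<le> 1 / R" for w :: complex
    using that \<open>R > 0\<close> by (simp add: norm_divide field_simps)
  have rnz: "poly (reflect_poly q) w \<noteq> 0" if "w \<in> cball 0 (1 / R)" for w
  proof (cases "w = 0")
    case False
    with that inv nz show ?thesis by (simp add: refl)
  qed (use \<open>q \<noteq> 0\<close> in \<open>simp add: poly_0_coeff_0\<close>)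
  have hval: "cmod (h w) = cmod (1 / w) / cmod (poly q (1 / w))" if "w \<noteq> 0" for w
  proof -
    have "degree q = Suc (degree q - 1)" using deg by simp
    then have "w ^ degree q = w * w ^ (degree q - 1)" by (metis power_Suc)
    with that show ?thesis by (simp add: h_def refl norm_divide norm_mult divide_simps)
  qed
  have "cmod (h (1 / z)) \<le> 1 / 2"
  proof (rule maximum_modulus_frontier[of h "cball 0 (1 / R)"])
    show "h holomorphic_on interior (cball 0 (1 / R))"
      unfolding h_def using rnz by (intro holomorphic_intros) (auto simp: less_imp_le)
    show "continuous_on (closure (cball 0 (1 / R))) h"
      unfolding h_def using rnz by (intro continuous_intros) auto
    fix w :: complex assume "w \<in> frontier (cball 0 (1 / R))"
    then have w: "cmod w = 1 / R" using \<open>R > 0\<close> by (simp add: frontier_cball)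
    then have w0: "w \<noteq> 0" and cw: "cmod (1 / w) = R" using \<open>R > 0\<close> by (auto simp: norm_divide)
    show "cmod (h w) \<le> 1 / 2"
      using bd[OF cw] cw \<open>R > 0\<close> unfolding hval[OF w0] by (simp add: divide_le_eq)
  qed (use z \<open>R > 0\<close> in \<open>auto simp: norm_divide intro: frac_le\<close>)
  moreover have "z \<noteq> 0" using z \<open>R > 0\<close> by auto
  moreover have "cmod (poly q z) > 0" using nz[OF z] by simp
  ultimately show ?thesis using hval[of "1 / z"] by (simp add: divide_le_eq)
qed

text \<open>Closeness in the spherical metric says little about the growth of \<open>g\<close> near
  infinity, since all large values are close to each other. It only gives modulus above
  \<open>2 * R\<close> on the exterior; the bound proportional to \<open>cmod z\<close> is then
  propagated from the circle \<open>cmod z = R\<close> by the maximum principle.\<close>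

lemma escape_radius_near:
  "\<exists>R\<ge>1. \<exists>e>0. \<forall>g. dist f g < e \<longrightarrow> (\<forall>z. R \<le> cmod z \<longrightarrow> 2 * cmod z \<le> cmod (poly (poly_of g) z))"
proof -
  let ?p = "poly_of f"
  have "((\<lambda>z. poly [:0, 1:] z / poly ?p z) \<longlongrightarrow> 0) at_infinity"
    by (rule poly_divide_tendsto_0_at_infinity) (use degree_poly_of[of f] in simp)
  then have "\<forall>\<^sub>F z in at_infinity. dist (poly [:0, 1:] z / poly ?p z) 0 < 1 / 3"
    by (rule tendstoD) simp
  moreover have "\<forall>\<^sub>F z in at_infinity. 0 < cmod (poly ?p z)"
    by (rule eventually_norm_poly_gt) (use degree_poly_of[of f] in simp)
  ultimately have "\<forall>\<^sub>F z in at_infinity. 3 * cmod z < cmod (poly ?p z)"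
    by eventually_elim (simp add: norm_divide field_simps)
  then obtain b where b: "\<And>z. b \<le> cmod z \<Longrightarrow> 3 * cmod z < cmod (poly ?p z)"
    by (auto simp: eventually_at_infinity)
  define R where "R = max b 1"
  have R: "R \<ge> 1" by (simp add: R_def)
  \<comment> \<open>The spherical width of the ring between the moduli \<open>2 * R\<close> and
    \<open>3 * R\<close>: a map within \<open>e\<close> of \<open>f\<close> loses at most this
    slack.\<close>
  define e where "e = arc_to_infinity (2 * R) - arc_to_infinity (3 * R)"
  have "e > 0" unfolding e_def using R arc_to_infinity_strict_antimono[of "2 * R" "3 * R"] by simp
  moreover have "2 * cmod z \<le> cmod (poly (poly_of g) z)" if g: "dist f g < e" and z: "R \<le> cmod z" for g z
  proof (rule exterior_maximum_principle[OF degree_poly_of])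
    have far: "2 * R < cmod (poly (poly_of g) z)" if z: "R \<le> cmod z" for z
    proof -
      have "3 * R < cmod (poly ?p z)" using b[of z] z unfolding R_def by linarith
      then have "dist (as_map f (Fin z)) Infty < arc_to_infinity (3 * R)"
        using R by (simp add: as_map_eq_poly_ext dist_Fin_Infty_less_iff)
      moreover have "dist (as_map f (Fin z)) (as_map g (Fin z)) < e"
        using dist_as_map_le g by (rule le_less_trans)
      ultimately have "dist (as_map g (Fin z)) Infty < arc_to_infinity (2 * R)"
        using dist_triangle3[of "as_map g (Fin z)" Infty "as_map f (Fin z)"] by (simp add: e_def)
      then show ?thesis
        using R by (simp add: as_map_eq_poly_ext dist_Fin_Infty_less_iff)
    qed
    show "poly (poly_of g) w \<noteq> 0" if "R \<le> cmod w" for w using far[OF that] R by auto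
    show "2 * cmod w \<le> cmod (poly (poly_of g) w)" if "cmod w = R" for w using far[of w] that by simp
  qed (use R z in auto)
  ultimately show ?thesis using R by blast
qed

definition escape_radius :: "polymap set \<Rightarrow> real \<Rightarrow> bool" where
  "escape_radius \<Gamma> R \<longleftrightarrow> 1 \<le> R \<and> (\<forall>f\<in>\<Gamma>. \<forall>z. R \<le> cmod z \<longrightarrow> 2 * cmod z \<le> cmod (poly (poly_of f) z))"

lemma compact_imp_escape_radius:
  assumes "compact \<Gamma>"
  obtains R where "escape_radius \<Gamma> R"
proof -
  have "\<forall>f. \<exists>R e. 1 \<le> R \<and> 0 < e \<and>
      (\<forall>g. dist f g < e \<longrightarrow> (\<forall>z. R \<le> cmod z \<longrightarrow> 2 * cmod z \<le> cmod (poly (poly_of g) z)))"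
    using escape_radius_near by blast
  from this[THEN choice] obtain r where "\<forall>f. \<exists>e. 1 \<le> r f \<and> 0 < e \<and>
      (\<forall>g. dist f g < e \<longrightarrow> (\<forall>z. r f \<le> cmod z \<longrightarrow> 2 * cmod z \<le> cmod (poly (poly_of g) z)))"
    by blast
  from this[THEN choice] obtain e where re: "\<And>f. 1 \<le> r f" "\<And>f. 0 < e f"
    "\<And>f g z. dist f g < e f \<Longrightarrow> r f \<le> cmod z \<Longrightarrow> 2 * cmod z \<le> cmod (poly (poly_of g) z)"
    by blast
  obtain K where K: "finite K" "\<Gamma> \<subseteq> (\<Union>f\<in>K. ball f (e f))"
  proof (rule compactE_image[OF assms, of \<Gamma> "\<lambda>f. ball f (e f)"])
    show "\<Gamma> \<subseteq> (\<Union>f\<in>\<Gamma>. ball f (e f))" using re(2) by auto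
  qed auto
  define R where "R = Max (insert 1 (r ` K))"
  have "2 * cmod z \<le> cmod (poly (poly_of g) z)" if g: "g \<in> \<Gamma>" and z: "R \<le> cmod z" for g z
  proof -
    obtain f where f: "f \<in> K" "dist f g < e f" using K(2) g by auto
    have "r f \<le> R" unfolding R_def using K(1) f by simp
    with z re(3)[OF f(2)] show ?thesis by simp
  qed
  moreover have "1 \<le> R" unfolding R_def using K(1) by simp
  ultimately show thesis using that unfolding escape_radius_def by blast
qed

primrec iterate_poly :: "(nat \<Rightarrow> polymap) \<Rightarrow> nat \<Rightarrow> complex poly" where
  "iterate_poly \<gamma> 0 = [:0, 1:]"
| "iterate_poly \<gamma> (Suc n) = pcompose (poly_of (\<gamma> n)) (iterate_poly \<gamma> n)"

lemma seq_comp_eq_poly_ext: "seq_comp \<gamma> n = poly_ext (iterate_poly \<gamma> n)"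
proof (induction n)
  case 0
  show ?case by (auto simp: fun_eq_iff poly_ext_def split: riemann_sphere.split)
next
  case (Suc n)
  then show ?case
    by (auto simp: fun_eq_iff as_map_eq_poly_ext poly_ext_def poly_pcompose split: riemann_sphere.split)
qed

lemma degree_iterate_poly: "degree (iterate_poly \<gamma> n) > 0"
proof (induction n)
  case (Suc n)
  with degree_poly_of[of "\<gamma> n"] show ?case by (simp add: degree_pcompose)
qed simp

lemma poly_iterate_poly_add:
  "poly (iterate_poly \<gamma> (m + n)) z
     = poly (iterate_poly (\<lambda>i. \<gamma> (m + i)) n) (poly (iterate_poly \<gamma> m) z)"
  by (induction n) (simp_all add: poly_pcompose)

lemma iterate_poly_escape:
  assumes "escape_radius \<Gamma> R" "\<And>i. \<gamma> i \<in> \<Gamma>" "R \<le> cmod z"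
  shows "2 ^ n * cmod z \<le> cmod (poly (iterate_poly \<gamma> n) z)"
proof (induction n)
  case (Suc n)
  have "1 * cmod z \<le> 2 ^ n * cmod z" by (intro mult_right_mono) auto
  with Suc assms(3) have "R \<le> cmod (poly (iterate_poly \<gamma> n) z)" by simp
  with assms(1,2) have "2 * cmod (poly (iterate_poly \<gamma> n) z) \<le> cmod (poly (iterate_poly \<gamma> (Suc n)) z)"
    by (simp add: escape_radius_def poly_pcompose)
  with Suc show ?case by simp
qed simp

lemma iterate_poly_escape_add:
  assumes "escape_radius \<Gamma> R" "\<And>i. \<gamma> i \<in> \<Gamma>" "R \<le> cmod (poly (iterate_poly \<gamma> m) z)"
  shows "2 ^ n * cmod (poly (iterate_poly \<gamma> m) z) \<le> cmod (poly (iterate_poly \<gamma> (m + n)) z)"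
  unfolding poly_iterate_poly_add by (rule iterate_poly_escape) (use assms in auto)

text \<open>Outer approximations, at finite times, of the set of points with bounded orbit; for an
  escape radius they decrease with \<open>n\<close>.\<close>

abbreviation stage :: "(nat \<Rightarrow> polymap) \<Rightarrow> real \<Rightarrow> nat \<Rightarrow> complex set" where
  "stage \<gamma> R n \<equiv> poly_lemniscate (iterate_poly \<gamma> n) R"

lemma stage_antimono:
  assumes "escape_radius \<Gamma> R" "\<And>i. \<gamma> i \<in> \<Gamma>" "m \<le> n"
  shows "stage \<gamma> R n \<subseteq> stage \<gamma> R m"
proof
  fix z assume z: "z \<in> stage \<gamma> R n"
  show "z \<in> stage \<gamma> R m"
  proof (rule ccontr)
    assume "z \<notin> stage \<gamma> R m"
    then have R: "R < cmod (poly (iterate_poly \<gamma> m) z)" by (simp add: poly_lemniscate_def)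
    have "1 * cmod (poly (iterate_poly \<gamma> m) z) \<le> 2 ^ (n - m) * cmod (poly (iterate_poly \<gamma> m) z)"
      by (intro mult_right_mono) auto
    also have "\<dots> \<le> cmod (poly (iterate_poly \<gamma> (m + (n - m))) z)"
      by (rule iterate_poly_escape_add) (use assms R in auto)
    finally show False using R z assms(3) by (simp add: poly_lemniscate_def)
  qed
qed

lemma arc_to_infinity_power_tendsto_0:
  assumes "1 \<le> R"
  shows "(\<lambda>n. arc_to_infinity (2 ^ n * R)) \<longlonglongrightarrow> 0"
proof (rule filterlim_compose[OF arc_to_infinity_tendsto_0])
  have "filterlim (\<lambda>n. (2::real) ^ n) at_top sequentially" by real_asymp
  then show "filterlim (\<lambda>n. 2 ^ n * R) at_top sequentially"
    using assms by (intro filterlim_at_top_mult_tendsto_pos[OF tendsto_const]) auto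
qed

text \<open>On the open set of points that are outside at time \<open>m\<close>, all late iterates
  are uniformly within \<open>e / 2\<close> of \<open>Infty\<close>; the finitely many earlier ones
  are handled by continuity.\<close>

lemma escaping_subset_fatou:
  assumes esc: "escape_radius \<Gamma> R" "\<And>i. \<gamma> i \<in> \<Gamma>"
    and x: "seq_comp \<gamma> m x \<in> insert Infty (Fin ` {z. R < cmod z})"
  shows "x \<in> fatou \<gamma>"
proof -
  have R: "1 \<le> R" using esc by (simp add: escape_radius_def)
  have cont: "continuous_on A (seq_comp \<gamma> n)" for A n
    unfolding seq_comp_eq_poly_ext by (intro continuous_on_poly_ext degree_iterate_poly)
  define V where "V = seq_comp \<gamma> m -` insert Infty (Fin ` {z. R < cmod z})"
  have "open V" unfolding V_def
    by (rule open_vimage[OF open_near_Infty cont]) (use R in simp)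
  moreover have "x \<in> V" using x by (simp add: V_def)
  moreover have "equicontinuous_on V {seq_comp \<gamma> n | n. n \<ge> 1}"
    unfolding equicontinuous_on_def
  proof (intro ballI allI impI)
    fix x and e :: real assume xV: "x \<in> V" and e: "e > 0"
    have "\<forall>\<^sub>F n in sequentially. arc_to_infinity (2 ^ n * R) < e / 2"
      using order_tendstoD(2)[OF arc_to_infinity_power_tendsto_0[OF R] half_gt_zero[OF e]] .
    then obtain N where N: "\<And>n. N \<le> n \<Longrightarrow> arc_to_infinity (2 ^ n * R) < e / 2"
      unfolding eventually_sequentially by blast
    have far: "dist (seq_comp \<gamma> n y) Infty < e / 2" if y: "y \<in> V" and n: "m + N \<le> n" for n y
    proof (cases y)
      case (Fin z)
      define w where "w = poly (iterate_poly \<gamma> m) z"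
      have w: "R < cmod w" using y Fin by (auto simp: V_def seq_comp_eq_poly_ext w_def)
      have "2 ^ (n - m) * R \<le> 2 ^ (n - m) * cmod w" using w by (intro mult_left_mono) auto
      also have "\<dots> \<le> cmod (poly (iterate_poly \<gamma> (m + (n - m))) z)"
        unfolding w_def by (rule iterate_poly_escape_add) (use esc w in \<open>auto simp: w_def\<close>)
      finally have "arc_to_infinity (cmod (poly (iterate_poly \<gamma> n) z)) \<le> arc_to_infinity (2 ^ (n - m) * R)"
        using n R by (intro arc_to_infinity_antimono) auto
      also have "\<dots> < e / 2" using n by (intro N) simp
      finally show ?thesis by (simp add: Fin seq_comp_eq_poly_ext dist_Fin_Infty)
    qed (use e in \<open>simp add: seq_comp_eq_poly_ext\<close>)
    have "\<forall>\<^sub>F y in nhds x. \<forall>n\<in>{..<m + N}. dist (seq_comp \<gamma> n y) (seq_comp \<gamma> n x) < e"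
    proof (intro eventually_ball_finite ballI)
      fix n
      have "isCont (seq_comp \<gamma> n) x"
        using cont[of UNIV n] by (simp add: continuous_on_eq_continuous_at)
      then have "(seq_comp \<gamma> n \<longlongrightarrow> seq_comp \<gamma> n x) (nhds x)"
        by (simp add: isCont_def tendsto_at_iff_tendsto_nhds)
      then show "\<forall>\<^sub>F y in nhds x. dist (seq_comp \<gamma> n y) (seq_comp \<gamma> n x) < e" using e by (rule tendstoD)
    qed simp
    then obtain d where d: "d > 0" "\<And>y n. dist y x < d \<Longrightarrow> n < m + N \<Longrightarrow>
        dist (seq_comp \<gamma> n y) (seq_comp \<gamma> n x) < e"
      unfolding eventually_nhds_metric by auto
    have "dist (seq_comp \<gamma> n y) (seq_comp \<gamma> n x) < e" if "y \<in> V" "dist y x < d" for n y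
    proof (cases "n < m + N")
      case False
      then show ?thesis
        using far[of y n] far[of x n] that xV
          dist_triangle2[of "seq_comp \<gamma> n y" "seq_comp \<gamma> n x" Infty] by simp
    qed (use d that in auto)
    with d(1) show "\<exists>d>0. \<forall>f\<in>{seq_comp \<gamma> n |n. n \<ge> 1}. \<forall>y\<in>V. dist y x < d \<longrightarrow> dist (f y) (f x) < e"
      by (intro exI[of _ d]) blast
  qed
  ultimately show ?thesis unfolding fatou_def by blast
qed

lemma julia_subset_stage:
  assumes "escape_radius \<Gamma> R" "\<And>i. \<gamma> i \<in> \<Gamma>"
  shows "julia \<gamma> \<subseteq> Fin ` stage \<gamma> R m"
proof
  fix x assume "x \<in> julia \<gamma>"
  then have "seq_comp \<gamma> m x \<notin> insert Infty (Fin ` {z. R < cmod z})"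
    using escaping_subset_fatou[of \<Gamma> R \<gamma>, OF assms] unfolding julia_def by blast
  then show "x \<in> Fin ` stage \<gamma> R m"
    by (cases x) (auto simp: seq_comp_eq_poly_ext poly_lemniscate_def image_iff not_less)
qed

text \<open>The orbit of \<open>x\<close> keeps distance at least \<open>arc_to_infinity R\<close>
  from \<open>Infty\<close>, whereas an escaping point arbitrarily near \<open>x\<close> eventually
  comes within half of that. No single \<open>d\<close> can then serve all iterates.\<close>

lemma bounded_orbit_near_escaping_in_julia:
  assumes esc: "escape_radius \<Gamma> R" "\<And>i. \<gamma> i \<in> \<Gamma>"
    and bdd: "\<And>n. x \<in> stage \<gamma> R n"
    and near: "\<And>W. open W \<Longrightarrow> x \<in> W \<Longrightarrow> \<exists>y\<in>W. \<exists>m. y \<notin> stage \<gamma> R m"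
  shows "Fin x \<in> julia \<gamma>"
proof (rule ccontr)
  assume "Fin x \<notin> julia \<gamma>"
  then obtain V where V: "open V" "Fin x \<in> V" "equicontinuous_on V {seq_comp \<gamma> n | n. n \<ge> 1}"
    by (auto simp: julia_def fatou_def)
  have R: "1 \<le> R" using esc by (simp add: escape_radius_def)
  define e where "e = arc_to_infinity R / 2"
  have e: "e > 0" using R arc_to_infinity_pos[of R] by (simp add: e_def)
  obtain d where d: "d > 0" "\<And>n y. n \<ge> 1 \<Longrightarrow> y \<in> V \<Longrightarrow> dist y (Fin x) < d \<Longrightarrow>
      dist (seq_comp \<gamma> n y) (seq_comp \<gamma> n (Fin x)) < e"
    using V(3)[unfolded equicontinuous_on_def, rule_format, OF V(2) e] by blast
  have "open (Fin -` (V \<inter> ball (Fin x) d))"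
    by (rule open_vimage[OF _ continuous_on_Fin]) (use V in auto)
  then obtain y m where y: "Fin y \<in> V" "dist (Fin y) (Fin x) < d" "y \<notin> stage \<gamma> R m"
    using near[of "Fin -` (V \<inter> ball (Fin x) d)"] V d by (auto simp: dist_commute)
  define w where "w = poly (iterate_poly \<gamma> m) y"
  have w: "R < cmod w" using y by (simp add: poly_lemniscate_def w_def)
  have "\<forall>\<^sub>F n in sequentially. arc_to_infinity (2 ^ n * R) < e"
    using order_tendstoD(2)[OF arc_to_infinity_power_tendsto_0[OF R] e] .
  then obtain N where N: "\<And>n. N \<le> n \<Longrightarrow> arc_to_infinity (2 ^ n * R) < e"
    by (auto simp: eventually_sequentially)
  \<comment> \<open>\<open>Suc\<close> guarantees \<open>n \<ge> 1\<close>: the family in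
    \<open>fatou\<close> does not include time 0.\<close>
  define n where "n = m + Suc N"
  have "2 ^ Suc N * R \<le> 2 ^ Suc N * cmod w" using w by (intro mult_left_mono) auto
  also have "\<dots> \<le> cmod (poly (iterate_poly \<gamma> n) y)"
    unfolding w_def n_def by (rule iterate_poly_escape_add) (use esc w in \<open>auto simp: w_def\<close>)
  finally have "arc_to_infinity (cmod (poly (iterate_poly \<gamma> n) y)) \<le> arc_to_infinity (2 ^ Suc N * R)"
    using R by (intro arc_to_infinity_antimono) auto
  with N[of "Suc N"] have 1: "dist (seq_comp \<gamma> n (Fin y)) Infty < e"
    by (simp add: seq_comp_eq_poly_ext dist_Fin_Infty)
  have 2: "dist (seq_comp \<gamma> n (Fin y)) (seq_comp \<gamma> n (Fin x)) < e"
    by (rule d(2)) (use y in \<open>auto simp: n_def\<close>)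
  have "arc_to_infinity R \<le> dist (seq_comp \<gamma> n (Fin x)) Infty"
    using bdd[of n] arc_to_infinity_antimono[of _ R]
    by (simp add: seq_comp_eq_poly_ext dist_Fin_Infty poly_lemniscate_def)
  with 1 2 dist_triangle3[of "seq_comp \<gamma> n (Fin x)" Infty "seq_comp \<gamma> n (Fin y)"]
  show False by (simp add: e_def)
qed

section \<open>Itineraries\<close>

lemma poly_has_root:
  fixes Q :: "complex poly"
  assumes "degree Q > 0"
  obtains z where "poly Q z = 0"
  using assms fundamental_theorem_of_algebra by (metis constant_degree less_irrefl)

lemma poly_lemniscate_iterate_subset_cball:
  assumes "escape_radius \<Gamma> R" "\<And>i. \<gamma> i \<in> \<Gamma>"
  shows "stage \<gamma> R n \<subseteq> cball 0 R"
  using stage_antimono[of \<Gamma> R \<gamma> 0 n, OF assms] by (auto simp: poly_lemniscate_def)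

lemma stage_add:
  "z \<in> stage \<gamma> R (m + n) \<longleftrightarrow> poly (iterate_poly \<gamma> m) z \<in> stage (\<lambda>i. \<gamma> (m + i)) R n"
  by (simp add: poly_lemniscate_def poly_iterate_poly_add)

text \<open>The piece covers the disc under the first \<open>m\<close> maps, and the disc contains a
  zero of the composition of the next \<open>n - m\<close> maps. Closedness of both parts survives
  because the stages decrease.\<close>

lemma clopen_piece_meets_later_stage:
  assumes esc: "escape_radius \<Gamma> R" "\<And>i. \<gamma> i \<in> \<Gamma>"
    and A: "A \<noteq> {}" "A \<subseteq> stage \<gamma> R m" "closed A" "closed (stage \<gamma> R m - A)"
    and "m \<le> n"
  shows "A \<inter> stage \<gamma> R n \<noteq> {}" "A \<inter> stage \<gamma> R n \<subseteq> stage \<gamma> R n"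
    "closed (A \<inter> stage \<gamma> R n)" "closed (stage \<gamma> R n - A \<inter> stage \<gamma> R n)"
proof -
  have R: "R > 0" using esc by (simp add: escape_radius_def)
  define \<eta> where "\<eta> i = \<gamma> (m + i)" for i
  obtain w where w: "poly (iterate_poly \<eta> (n - m)) w = 0"
    using poly_has_root[OF degree_iterate_poly] by blast
  then have ws: "w \<in> stage \<eta> R (n - m)" using R by (simp add: poly_lemniscate_def)
  moreover have "stage \<eta> R (n - m) \<subseteq> cball 0 R"
    by (rule poly_lemniscate_iterate_subset_cball[OF esc(1)]) (simp add: \<eta>_def esc)
  ultimately have "w \<in> cball 0 R" by blast
  then obtain a where a: "a \<in> A" "poly (iterate_poly \<gamma> m) a = w"
    using cball_subset_image_clopen_piece[OF degree_iterate_poly R A] by blast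
  then have "a \<in> stage \<gamma> R (m + (n - m))"
    using ws unfolding stage_add by (simp add: \<eta>_def[abs_def])
  with a \<open>m \<le> n\<close> show "A \<inter> stage \<gamma> R n \<noteq> {}" by auto
  have sub: "stage \<gamma> R n \<subseteq> stage \<gamma> R m" by (rule stage_antimono) (use esc \<open>m \<le> n\<close> in auto)
  show "closed (A \<inter> stage \<gamma> R n)" using A closed_poly_lemniscate by (intro closed_Int)
  have "stage \<gamma> R n - A \<inter> stage \<gamma> R n = stage \<gamma> R n \<inter> (stage \<gamma> R m - A)" using sub by blast
  then show "closed (stage \<gamma> R n - A \<inter> stage \<gamma> R n)"
    using A(4) closed_poly_lemniscate by (simp add: closed_Int)
qed simp

text \<open>The \<open>k\<close>-th window consists of the \<open>N\<close> maps starting at time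
  \<open>m k\<close>, and \<open>B k True\<close>, \<open>B k False\<close> split the preimage of
  the disc under these maps alone. Windows do not overlap, so the cut made by one is complete before
  the next begins.\<close>

locale splitting_windows =
  fixes \<Gamma> R \<gamma> N m and B :: "nat \<Rightarrow> bool \<Rightarrow> complex set"
  assumes esc: "escape_radius \<Gamma> R" and \<gamma>: "\<And>i. \<gamma> i \<in> \<Gamma>"
    and spaced: "\<And>k. m k + N \<le> m (Suc k)"
    and closed_B: "\<And>k b. closed (B k b)" and B_ne: "\<And>k b. B k b \<noteq> {}"
    and B_disjoint: "\<And>k. B k True \<inter> B k False = {}"
    and B_Un: "\<And>k. B k True \<union> B k False = stage (\<lambda>i. \<gamma> (m k + i)) R N"
begin

definition itinerary_piece :: "(nat \<Rightarrow> bool) \<Rightarrow> nat \<Rightarrow> complex set" where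
  "itinerary_piece s k = {z. \<forall>j\<le>k. poly (iterate_poly \<gamma> (m j)) z \<in> B j (s j)}"

lemma R_pos: "R > 0"
  using esc by (simp add: escape_radius_def)

lemma closed_preimage_B: "closed {z. poly (iterate_poly \<gamma> n) z \<in> B j b}"
  using continuous_closed_vimage[OF closed_B, of "poly (iterate_poly \<gamma> n)" j b]
  by (simp add: vimage_def)

lemma B_subset: "B k b \<subseteq> stage (\<lambda>i. \<gamma> (m k + i)) R N"
  using B_Un[of k] by (cases b) auto

lemma B_Not_iff: "w \<in> stage (\<lambda>i. \<gamma> (m k + i)) R N \<Longrightarrow> w \<in> B k (\<not> b) \<longleftrightarrow> w \<notin> B k b"
  using B_Un[of k] B_disjoint[of k] by (cases b) auto

lemma stage_m_iff: "z \<in> stage \<gamma> R (m k + N) \<longleftrightarrow>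
    poly (iterate_poly \<gamma> (m k)) z \<in> stage (\<lambda>i. \<gamma> (m k + i)) R N"
  by (rule stage_add)

lemma m_mono: "j \<le> k \<Longrightarrow> m j \<le> m k"
  by (rule lift_Suc_mono_le[of m]) (use spaced in \<open>auto intro: order_trans[OF le_add1]\<close>)

lemma closed_itinerary_piece: "closed (itinerary_piece s k)"
proof -
  have "itinerary_piece s k = (\<Inter>j\<in>{..k}. {z. poly (iterate_poly \<gamma> (m j)) z \<in> B j (s j)})"
    by (auto simp: itinerary_piece_def)
  then show ?thesis using closed_preimage_B by auto
qed

lemma itinerary_piece_subset: "itinerary_piece s k \<subseteq> stage \<gamma> R (m k + N)"
  using B_subset[of k "s k"] by (auto simp: itinerary_piece_def stage_m_iff)

text \<open>A point of the stage has passed all windows up to \<open>k\<close>, so it lies in one of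
  the two halves at each. Leaving the piece means taking the opposite half at one of finitely many
  windows, a closed condition.\<close>

lemma closed_stage_minus_itinerary_piece: "closed (stage \<gamma> R (m k + N) - itinerary_piece s k)"
proof -
  have "stage \<gamma> R (m k + N) - itinerary_piece s k =
    stage \<gamma> R (m k + N) \<inter> (\<Union>j\<in>{..k}. {z. poly (iterate_poly \<gamma> (m j)) z \<in> B j (\<not> s j)})"
  proof -
    have "poly (iterate_poly \<gamma> (m j)) z \<in> B j (\<not> s j) \<longleftrightarrow> poly (iterate_poly \<gamma> (m j)) z \<notin> B j (s j)"
      if "z \<in> stage \<gamma> R (m k + N)" "j \<le> k" for z j
    proof (rule B_Not_iff)
      have "stage \<gamma> R (m k + N) \<subseteq> stage \<gamma> R (m j + N)"
        by (rule stage_antimono[OF esc \<gamma>]) (use m_mono[OF that(2)] in simp)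
      with that(1) show "poly (iterate_poly \<gamma> (m j)) z \<in> stage (\<lambda>i. \<gamma> (m j + i)) R N"
        using stage_m_iff by blast
    qed
    then show ?thesis unfolding itinerary_piece_def by blast
  qed
  also have "closed \<dots>"
    using closed_preimage_B by (intro closed_Int closed_poly_lemniscate closed_UN) auto
  finally show ?thesis .
qed

text \<open>Both halves lie in the disc, and the piece covers the disc. Hence either choice remains
  available after any history.\<close>

lemma clopen_piece_meets_B:
  assumes "A \<noteq> {}" "A \<subseteq> stage \<gamma> R (m k)" "closed A" "closed (stage \<gamma> R (m k) - A)"
  shows "\<exists>z\<in>A. poly (iterate_poly \<gamma> (m k)) z \<in> B k b"
proof -
  obtain w where w: "w \<in> B k b" using B_ne by blast
  moreover have "stage (\<lambda>i. \<gamma> (m k + i)) R N \<subseteq> cball 0 R"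
    by (rule poly_lemniscate_iterate_subset_cball[OF esc]) (rule \<gamma>)
  ultimately have "w \<in> cball 0 R" using B_subset by blast
  then show ?thesis
    using cball_subset_image_clopen_piece[OF degree_iterate_poly R_pos assms] w by blast
qed

lemma itinerary_piece_ne: "itinerary_piece s k \<noteq> {}"
proof (induction k)
  case 0
  obtain z where z: "poly (iterate_poly \<gamma> (m 0)) z = 0"
    using poly_has_root[OF degree_iterate_poly] by blast
  have "\<exists>z\<in>stage \<gamma> R (m 0). poly (iterate_poly \<gamma> (m 0)) z \<in> B 0 (s 0)"
  proof (rule clopen_piece_meets_B)
    have "z \<in> stage \<gamma> R (m 0)" using z R_pos by (simp add: poly_lemniscate_def)
    then show "stage \<gamma> R (m 0) \<noteq> {}" by blast
  qed (use closed_poly_lemniscate in auto)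
  then show ?case by (auto simp: itinerary_piece_def)
next
  case (Suc k)
  \<comment> \<open>The trace of the current piece on stage \<open>m (Suc k)\<close> is again a
    nonempty clopen piece, from which either half of the next window can be entered.\<close>
  note piece = clopen_piece_meets_later_stage[OF esc \<gamma> Suc itinerary_piece_subset
      closed_itinerary_piece closed_stage_minus_itinerary_piece spaced]
  obtain z where "z \<in> itinerary_piece s k" "poly (iterate_poly \<gamma> (m (Suc k))) z \<in> B (Suc k) (s (Suc k))"
    using clopen_piece_meets_B[OF piece] by blast
  then have "z \<in> itinerary_piece s (Suc k)" by (auto simp: itinerary_piece_def le_Suc_eq)
  then show ?case by blast
qed

lemma m_ge: "N > 0 \<Longrightarrow> k \<le> m k"
proof (induction k)
  case (Suc k)
  then show ?case using spaced[of k] by simp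
qed simp

definition itinerary_set :: "(nat \<Rightarrow> bool) \<Rightarrow> complex set" where
  "itinerary_set s = (\<Inter>k. itinerary_piece s k)"

lemma closed_itinerary_set: "closed (itinerary_set s)"
  unfolding itinerary_set_def using closed_itinerary_piece by auto

lemma itinerary_set_subset_stage:
  assumes "N > 0"
  shows "itinerary_set s \<subseteq> stage \<gamma> R n"
proof -
  have "itinerary_set s \<subseteq> itinerary_piece s n" by (auto simp: itinerary_set_def)
  also have "\<dots> \<subseteq> stage \<gamma> R (m n + N)" by (rule itinerary_piece_subset)
  also have "\<dots> \<subseteq> stage \<gamma> R n"
    by (rule stage_antimono[OF esc \<gamma>]) (use m_ge[OF assms, of n] in simp)
  finally show ?thesis .
qed

lemma itinerary_set_ne: "itinerary_set s \<noteq> {}"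
  unfolding itinerary_set_def
proof (rule compact_nest)
  show "compact (itinerary_piece s k)" for k
    using closed_itinerary_piece itinerary_piece_subset compact_poly_lemniscate[OF degree_iterate_poly]
    by (metis closed_Int_compact inf.absorb1)
  show "itinerary_piece s k \<noteq> {}" for k by (rule itinerary_piece_ne)
qed (auto simp: itinerary_piece_def)

text \<open>Leaving the itinerary set forces passing through a point outside a clopen piece of some
  stage, that is, an escaping point.\<close>

lemma frontier_itinerary_set_in_julia:
  assumes "N > 0" "x \<in> frontier (itinerary_set s)"
  shows "Fin x \<in> julia \<gamma>"
proof (rule bounded_orbit_near_escaping_in_julia[OF esc \<gamma>])
  have x: "x \<in> itinerary_set s"
    using assms(2) closed_itinerary_set frontier_subset_closed by blast
  then show "x \<in> stage \<gamma> R n" for n using itinerary_set_subset_stage[OF assms(1)] by blast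
  fix W assume W: "open W" "x \<in> W"
  then obtain r where r: "r > 0" "ball x r \<subseteq> W" by (meson openE)
  obtain y where y: "y \<in> ball x r" "y \<notin> itinerary_set s"
    using assms(2) r(1) unfolding frontier_straddle by (auto simp: mem_ball)
  then obtain k where k: "y \<notin> itinerary_piece s k" by (auto simp: itinerary_set_def)
  have xk: "x \<in> itinerary_piece s k" using x by (auto simp: itinerary_set_def)
  \<comment> \<open>Inside the stage, the piece and its complement would disconnect the ball, since
    one contains \<open>x\<close> and the other \<open>y\<close>. The escaping point obtained this
    way may differ from \<open>y\<close>.\<close>
  have "\<not> ball x r \<subseteq> stage \<gamma> R (m k + N)"
  proof
    assume sub: "ball x r \<subseteq> stage \<gamma> R (m k + N)"
    have "\<not> connected (ball x r)"
      unfolding connected_closed not_not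
    proof (intro exI conjI)
      show "closed (itinerary_piece s k)" by (rule closed_itinerary_piece)
      show "closed (stage \<gamma> R (m k + N) - itinerary_piece s k)"
        by (rule closed_stage_minus_itinerary_piece)
      show "itinerary_piece s k \<inter> ball x r \<noteq> {}" using xk r by auto
      show "(stage \<gamma> R (m k + N) - itinerary_piece s k) \<inter> ball x r \<noteq> {}" using y k sub by blast
    qed (use sub in auto)
    then show False by simp
  qed
  with r show "\<exists>y\<in>W. \<exists>n. y \<notin> stage \<gamma> R n" by blast
qed

text \<open>Itineraries inject into components: if two of them differ at window \<open>k\<close>, a
  common component would be a connected subset of stage \<open>m k + N\<close> meeting both halves
  of that window.\<close>

lemma uncountable_components_julia:
  assumes "N > 0"
  shows "uncountable (components (julia \<gamma>))"
proof -
  have "frontier (itinerary_set s) \<noteq> {}" for s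
  proof -
    have "bounded (itinerary_set s)"
      using itinerary_set_subset_stage[OF assms, of s 0] bounded_poly_lemniscate[OF degree_iterate_poly]
        bounded_subset by blast
    then have "itinerary_set s \<noteq> UNIV" using not_bounded_UNIV by auto
    with itinerary_set_ne show ?thesis by (simp add: frontier_eq_empty)
  qed
  then have "\<forall>s. \<exists>x. x \<in> frontier (itinerary_set s)" by blast
  from this[THEN choice] obtain x where x: "\<And>s. x s \<in> frontier (itinerary_set s)" by blast
  have xJ: "Fin (x s) \<in> julia \<gamma>" for s by (rule frontier_itinerary_set_in_julia[OF assms x])
  have xs: "x s \<in> itinerary_set s" for s
    using x closed_itinerary_set frontier_subset_closed by blast
  define C where "C s = connected_component_set (julia \<gamma>) (Fin (x s))" for s
  have "inj C"
  proof (rule injI, rule ccontr)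
    fix s t assume eq: "C s = C t" and "s \<noteq> t"
    then obtain k where k: "s k \<noteq> t k" by auto
    have conn: "connected (C s)" by (simp add: C_def)
    have CJ: "C s \<subseteq> julia \<gamma>" unfolding C_def by (rule connected_component_subset)
    then have CE: "C s \<subseteq> Fin ` stage \<gamma> R (m k + N)"
      using julia_subset_stage[of \<Gamma> R \<gamma>, OF esc \<gamma>] by blast
    then have "C s \<subseteq> - {Infty}" by auto
    \<comment> \<open>The halves are planar sets, so the component is moved from the sphere to the
      plane; it avoids \<open>Infty\<close>, where \<open>to_complex\<close> would only return a
      default value.\<close>
    define D where "D = to_complex ` C s"
    have "connected D"
      unfolding D_def using \<open>C s \<subseteq> - {Infty}\<close>
      by (intro connected_continuous_image conn continuous_on_subset[OF continuous_on_to_complex])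
    have sub: "D \<subseteq> stage \<gamma> R (m k + N)" using CE by (force simp: D_def)
    have "Fin (x s) \<in> C s" for s using xJ[of s] by (simp add: C_def)
    from this[of s] this[of t] have "Fin (x s) \<in> C s" "Fin (x t) \<in> C s" by (simp_all add: eq)
    then have in_D: "x s \<in> D" "x t \<in> D"
      unfolding D_def by (force intro: rev_image_eqI)+
    define F where "F b = {z. poly (iterate_poly \<gamma> (m k)) z \<in> B k b}" for b
    have in_F: "x s \<in> F (s k)" for s
      using xs[of s] by (auto simp: itinerary_set_def itinerary_piece_def F_def)
    have meet: "F b \<inter> D \<noteq> {}" for b
    proof -
      have "b = s k \<or> b = t k" using k by auto
      then show ?thesis using in_F[of s] in_F[of t] in_D by auto
    qed
    have "\<not> connected D"
      unfolding connected_closed not_not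
    proof (intro exI conjI)
      show "closed (F True)" "closed (F False)" unfolding F_def by (rule closed_preimage_B)+
      show "F True \<inter> D \<noteq> {}" "F False \<inter> D \<noteq> {}" by (rule meet)+
      show "F True \<inter> F False \<inter> D = {}" using B_disjoint[of k] by (auto simp: F_def)
      have "z \<in> F True \<union> F False" if "z \<in> stage \<gamma> R (m k + N)" for z
        using that B_Un[of k] unfolding stage_m_iff F_def by auto
      with sub show "D \<subseteq> F True \<union> F False" by blast
    qed
    with \<open>connected D\<close> show False by simp
  qed
  moreover have "range C \<subseteq> components (julia \<gamma>)"
    using xJ by (auto simp: C_def components_def)
  moreover have "uncountable (UNIV :: (nat \<Rightarrow> bool) set)"
  proof
    assume "countable (UNIV :: (nat \<Rightarrow> bool) set)"
    then obtain f :: "nat \<Rightarrow> nat \<Rightarrow> bool" where f: "range f = UNIV"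
      using uncountable_def by blast
    obtain n where "f n = (\<lambda>k. \<not> f k k)" using f by (metis UNIV_I image_iff)
    then show False by (metis)
  qed
  ultimately show ?thesis
    by (metis countable_image_inj_eq countable_subset)
qed

end

lemma uncountable_components_julia_if_infinitely_many_splittings:
  assumes esc: "escape_radius \<Gamma> R" "\<And>i. \<gamma> i \<in> \<Gamma>"
    and inf: "\<exists>\<^sub>\<infinity>m. \<not> connected (stage (\<lambda>i. \<gamma> (m + i)) R N)" and "N > 0"
  shows "uncountable (components (julia \<gamma>))"
proof -
  define P where "P m \<longleftrightarrow> \<not> connected (stage (\<lambda>i. \<gamma> (m + i)) R N)" for m
  have "\<exists>y. P y \<and> x + N \<le> y" for x using inf unfolding P_def[symmetric] INFM_nat_le by blast
  then obtain m where m: "\<And>k. P (m k)" "\<And>k. m k + N \<le> m (Suc k)"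
    using dependent_nat_choice[of "\<lambda>_. P" "\<lambda>_ x y. x + N \<le> y"] by metis
  have "\<exists>B::bool \<Rightarrow> complex set. (\<forall>b. closed (B b) \<and> B b \<noteq> {}) \<and> B True \<inter> B False = {}
    \<and> B True \<union> B False = stage (\<lambda>i. \<gamma> (m k + i)) R N" for k
  proof -
    obtain B\<^sub>1 B\<^sub>2 where "closed B\<^sub>1" "closed B\<^sub>2" "B\<^sub>1 \<noteq> {}" "B\<^sub>2 \<noteq> {}" "B\<^sub>1 \<inter> B\<^sub>2 = {}"
      "B\<^sub>1 \<union> B\<^sub>2 = stage (\<lambda>i. \<gamma> (m k + i)) R N"
      using m(1)[of k] unfolding P_def connected_closed_set[OF closed_poly_lemniscate] by blast
    then show ?thesis by (intro exI[of _ "\<lambda>b. if b then B\<^sub>1 else B\<^sub>2"]) auto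
  qed
  then obtain B :: "nat \<Rightarrow> bool \<Rightarrow> complex set" where B:
    "\<And>k b. closed (B k b)" "\<And>k b. B k b \<noteq> {}" "\<And>k. B k True \<inter> B k False = {}"
    "\<And>k. B k True \<union> B k False = stage (\<lambda>i. \<gamma> (m k + i)) R N"
    by metis
  interpret splitting_windows \<Gamma> R \<gamma> N m B
    by unfold_locales (use esc m B in auto)
  show ?thesis by (rule uncountable_components_julia[OF \<open>N > 0\<close>])
qed

section \<open>Splitting words\<close>

lemma seq_comp_add:
  "seq_comp \<gamma> (m + n) = seq_comp (\<lambda>i. \<gamma> (m + i)) n \<circ> seq_comp \<gamma> m"
  by (induction n) (simp_all add: comp_assoc)

lemma seq_comp_cong: "(\<And>i. i < n \<Longrightarrow> \<gamma> i = \<eta> i) \<Longrightarrow> seq_comp \<gamma> n = seq_comp \<eta> n"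
  by (induction n) auto

lemma generated_semigroup_eq_seq_comp:
  assumes "g \<in> generated_semigroup (as_map ` \<Gamma>)"
  shows "\<exists>h N. (\<forall>i. h i \<in> \<Gamma>) \<and> N > 0 \<and> g = seq_comp h N"
  using assms
proof induction
  case (gen f)
  then obtain p where "p \<in> \<Gamma>" "f = as_map p" by blast
  then show ?case by (intro exI[of _ "\<lambda>_. p"] exI[of _ 1]) auto
next
  case (comp f g)
  then obtain h N k M where h: "\<forall>i. h i \<in> \<Gamma>" "N > 0" "f = seq_comp h N"
    and k: "\<forall>i. k i \<in> \<Gamma>" "M > 0" "g = seq_comp k M" by blast
  \<comment> \<open>In \<open>f \<circ> g\<close> the map \<open>g\<close> acts first, so its word
    of length \<open>M\<close> precedes that of \<open>f\<close>.\<close>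
  define c where "c i = (if i < M then k i else h (i - M))" for i
  have "seq_comp c (M + N) = f \<circ> g"
    unfolding seq_comp_add h k
    by (intro arg_cong2[where f = "(\<circ>)"] seq_comp_cong) (auto simp: c_def)
  moreover have "\<forall>i. c i \<in> \<Gamma>" using h k by (simp add: c_def)
  ultimately show ?case using h(2) by (intro exI[of _ c] exI[of _ "M + N"]) simp
qed

lemma critical_point_poly_ext:
  assumes "critical_point (poly_ext Q) (Fin c)"
  shows "poly (pderiv Q) c = 0"
proof -
  have "(\<lambda>w. coord (poly_ext Q (Fin c)) (poly_ext Q (coord_inv (Fin c) w))) = poly Q"
    by (simp add: coord_def coord_inv_def fun_eq_iff)
  with assms have "(poly Q has_field_derivative 0) (at c)"
    by (simp add: critical_point_def coord_def)
  then show ?thesis using poly_DERIV DERIV_unique by blast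
qed

text \<open>Uniformity in \<open>x\<close> rests on compactness of the sphere, which makes every
  \<open>h i\<close> uniformly continuous.\<close>

lemma seq_comp_continuous_in_generators:
  assumes "d > 0"
  shows "\<exists>e>0. \<forall>g. (\<forall>i<N. dist (g i) (h i) < e) \<longrightarrow> (\<forall>x. dist (seq_comp g N x) (seq_comp h N x) < d)"
  using assms
proof (induction N arbitrary: d)
  case 0
  then show ?case by (auto intro: exI[of _ 1])
next
  case (Suc N)
  obtain d' where d': "d' > 0" "\<And>x y. dist y x < d' \<Longrightarrow> dist (as_map (h N) y) (as_map (h N) x) < d / 2"
    using uniformly_continuous_as_map[of "h N"] half_gt_zero[OF Suc.prems]
    unfolding uniformly_continuous_on_def by (metis UNIV_I)
  obtain e where e: "e > 0" "\<And>g x. (\<forall>i<N. dist (g i) (h i) < e) \<Longrightarrow>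
      dist (seq_comp g N x) (seq_comp h N x) < d'"
    using Suc.IH[OF d'(1)] by blast
  have "dist (seq_comp g (Suc N) x) (seq_comp h (Suc N) x) < d"
    if g: "\<forall>i<Suc N. dist (g i) (h i) < min e (d / 2)" for g x
  proof -
    have "dist (seq_comp g N x) (seq_comp h N x) < d'" by (rule e(2)) (use g in auto)
    from d'(2)[OF this]
    have "dist (as_map (h N) (seq_comp g N x)) (seq_comp h (Suc N) x) < d / 2" by simp
    moreover have "dist (g N) (h N) < d / 2" using g by auto
    then have "dist (seq_comp g (Suc N) x) (as_map (h N) (seq_comp g N x)) < d / 2"
      using dist_as_map_le[of "g N" "seq_comp g N x" "h N"] by simp
    ultimately show ?thesis
      using dist_triangle[of "seq_comp g (Suc N) x" "seq_comp h (Suc N) x"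
          "as_map (h N) (seq_comp g N x)"] by linarith
  qed
  then show ?case using e(1) Suc.prems by (intro exI[of _ "min e (d / 2)"]) auto
qed

lemma compact_closed_dist_bounded_below:
  fixes S T :: "'a::metric_space set"
  assumes "compact S" "closed T" "S \<inter> T = {}"
  shows "\<exists>d>0. \<forall>x\<in>S. \<forall>y\<in>T. d \<le> dist x y"
proof -
  obtain d where d: "d > 0" "\<And>x. x \<in> S \<Longrightarrow> \<exists>G\<in>{- T}. ball x d \<subseteq> G"
    by (rule Heine_Borel_lemma[of S "{- T}"]) (use assms in auto)
  have "d \<le> dist x y" if "x \<in> S" "y \<in> T" for x y
  proof (rule ccontr)
    assume "\<not> d \<le> dist x y"
    then have "y \<in> ball x d" by simp
    with d(2)[OF that(1)] that(2) show False by auto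
  qed
  with d(1) show ?thesis by blast
qed

text \<open>Each part of the separated lemniscate contains a root of \<open>Q\<close>. A nearby
  \<open>P\<close> still sends these roots into the disc, and sends everything outside the
  separating neighbourhoods \<open>U\<close> and \<open>V\<close> off the disc, so both parts
  persist.\<close>

lemma disconnected_lemniscate_stable:
  assumes Q: "degree Q > 0" and R: "R > 0" and disc: "\<not> connected (poly_lemniscate Q R)"
  obtains d where "d > 0" "\<And>P. (\<And>x. dist (poly_ext P x) (poly_ext Q x) < d) \<Longrightarrow>
    \<not> connected (poly_lemniscate P R)"
proof -
  obtain A B where AB: "closed A" "closed B" "A \<noteq> {}" "B \<noteq> {}" "A \<union> B = poly_lemniscate Q R" "A \<inter> B = {}"
    using disc unfolding connected_closed_set[OF closed_poly_lemniscate] by blast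
  have "poly_lemniscate Q R - A = B" "poly_lemniscate Q R - B = A" using AB by blast+
  then have "cball 0 R \<subseteq> poly Q ` A" "cball 0 R \<subseteq> poly Q ` B"
    using cball_subset_image_clopen_piece[OF Q R, of A] cball_subset_image_clopen_piece[OF Q R, of B] AB
    by auto
  moreover have "0 \<in> cball (0::complex) R" using R by simp
  ultimately have "0 \<in> poly Q ` A" "0 \<in> poly Q ` B" by (auto dest: subsetD)
  then obtain a b where ab: "a \<in> A" "poly Q a = 0" "b \<in> B" "poly Q b = 0" by force
  obtain U V where UV: "open U" "open V" "A \<subseteq> U" "B \<subseteq> V" "U \<inter> V = {}"
    using separation_normal[OF AB(1,2,6)] by blast
  \<comment> \<open>Taken in the sphere, hence containing \<open>Infty\<close> and compact: this
    gives one positive distance even for points of large modulus.\<close>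
  define K where "K = - (Fin ` (U \<union> V))"
  have "closed K" unfolding K_def using UV by (intro closed_Compl open_Fin_image) auto
  then have "compact K" using compact_UNIV_riemann_sphere compact_Int_closed[of UNIV K] by simp
  then have "compact (poly_ext Q ` K)"
    by (intro compact_continuous_image continuous_on_poly_ext Q)
  moreover have "closed (Fin ` cball 0 R)"
    by (intro compact_imp_closed compact_continuous_image continuous_on_Fin) simp
  moreover have "poly_ext Q ` K \<inter> Fin ` cball 0 R = {}"
  proof -
    have "poly_ext Q x \<notin> Fin ` cball 0 R" if "x \<in> K" for x
    proof
      assume "poly_ext Q x \<in> Fin ` cball 0 R"
      then obtain z where z: "x = Fin z" "cmod (poly Q z) \<le> R" by (cases x) auto
      then have "z \<in> U \<union> V" using AB(5) UV by (auto simp: poly_lemniscate_def)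
      with that z show False by (simp add: K_def)
    qed
    then show ?thesis by blast
  qed
  ultimately have "\<exists>d>0. \<forall>x\<in>poly_ext Q ` K. \<forall>y\<in>Fin ` cball 0 R. d \<le> dist x y"
    by (rule compact_closed_dist_bounded_below)
  then obtain d where d: "d > 0" "\<And>x y. x \<in> poly_ext Q ` K \<Longrightarrow> y \<in> Fin ` cball 0 R \<Longrightarrow> d \<le> dist x y"
    by blast
  have "open (Fin ` ball 0 R)" by (rule open_Fin_image) simp
  then obtain d' where d': "d' > 0" "ball (Fin 0) d' \<subseteq> Fin ` ball 0 R"
    using R by (metis centre_in_ball imageI openE)
  have "\<not> connected (poly_lemniscate P R)"
    if P: "\<And>x. dist (poly_ext P x) (poly_ext Q x) < min d d'" for P
  proof -
    have root: "z \<in> poly_lemniscate P R" if "poly Q z = 0" for z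
    proof -
      have "Fin (poly P z) \<in> ball (Fin 0) d'" using P[of "Fin z"] that by (simp add: dist_commute)
      with d'(2) show ?thesis by (auto simp: poly_lemniscate_def)
    qed
    have cover: "poly_lemniscate P R \<subseteq> U \<union> V"
    proof
      fix z assume z: "z \<in> poly_lemniscate P R"
      show "z \<in> U \<union> V"
      proof (rule ccontr)
        assume "z \<notin> U \<union> V"
        then have "Fin z \<in> K" by (auto simp: K_def)
        moreover have "poly_ext P (Fin z) \<in> Fin ` cball 0 R"
          using z by (simp add: poly_lemniscate_def)
        ultimately have "d \<le> dist (poly_ext Q (Fin z)) (poly_ext P (Fin z))"
          by (intro d(2) imageI)
        with P[of "Fin z"] show False by (simp add: dist_commute)
      qed
    qed
    show ?thesis
      unfolding connected_def not_not
    proof (intro exI conjI)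
      show "poly_lemniscate P R \<subseteq> U \<union> V" by (rule cover)
      show "U \<inter> poly_lemniscate P R \<noteq> {}" using root[OF ab(2)] ab UV by blast
      show "V \<inter> poly_lemniscate P R \<noteq> {}" using root[OF ab(4)] ab UV by blast
    qed (use UV in auto)
  qed
  with d(1) d'(1) that[of "min d d'"] show thesis by auto
qed

lemma unbounded_postcritical_imp_stable_splitting:
  assumes esc: "escape_radius \<Gamma> R"
    and unb: "\<not> bounded (Fin -` planar_postcritical (generated_semigroup (as_map ` \<Gamma>)))"
  obtains h N e where "\<And>i. h i \<in> \<Gamma>" "N > 0" "e > 0"
    "\<And>g. (\<forall>i<N. dist (h i) (g i) < e) \<Longrightarrow> \<not> connected (stage g R N)"
proof -
  let ?G = "generated_semigroup (as_map ` \<Gamma>)"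
  have R: "R > 0" using esc by (simp add: escape_radius_def)
  obtain v where v: "Fin v \<in> planar_postcritical ?G" "R < cmod v"
    using unb unfolding bounded_iff by (metis linorder_not_less vimageD)
  \<comment> \<open>Unboundedness concerns a closure; since the exterior of the disc is open, it
    contains an actual critical value as well.\<close>
  have "open (Fin ` {z. R < cmod z})"
    by (intro open_Fin_image open_Collect_less continuous_intros)
  moreover have "Fin v \<in> Fin ` {z. R < cmod z} \<inter> closure (\<Union>g\<in>?G. critical_values g)"
    using v by (auto simp: planar_postcritical_def postcritical_def)
  ultimately have "Fin ` {z. R < cmod z} \<inter> (\<Union>g\<in>?G. critical_values g) \<noteq> {}"
    using open_Int_closure_eq_empty by blast
  then obtain g w where g: "g \<in> ?G" and w: "R < cmod w" "Fin w \<in> critical_values g" by blast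
  obtain h N where h: "\<And>i. h i \<in> \<Gamma>" "N > 0" "g = seq_comp h N"
    using generated_semigroup_eq_seq_comp[OF g] by blast
  define Q where "Q = iterate_poly h N"
  have gQ: "g = poly_ext Q" by (simp add: h seq_comp_eq_poly_ext Q_def)
  have Q: "degree Q > 0" unfolding Q_def by (rule degree_iterate_poly)
  obtain x where x: "critical_point g x" "g x = Fin w"
    using w(2) by (auto simp: critical_values_def)
  \<comment> \<open>\<open>Infty\<close> is fixed by \<open>g\<close>, so a critical point with
    finite value is finite.\<close>
  then obtain c where c: "x = Fin c" "poly Q c = w" by (cases x) (auto simp: gQ)
  have "poly (pderiv Q) c = 0" using x(1) unfolding c gQ by (rule critical_point_poly_ext)
  then have "\<not> connected (poly_lemniscate Q R)"
    using connected_lemniscate_no_exterior_critical_point[OF Q R, of c] w(1) c by blast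
  then obtain d where d: "d > 0" "\<And>P. (\<And>x. dist (poly_ext P x) (poly_ext Q x) < d) \<Longrightarrow>
      \<not> connected (poly_lemniscate P R)"
    using disconnected_lemniscate_stable[OF Q R] by blast
  obtain e where e: "e > 0" "\<And>g x. (\<forall>i<N. dist (g i) (h i) < e) \<Longrightarrow>
      dist (seq_comp g N x) (seq_comp h N x) < d"
    using seq_comp_continuous_in_generators[OF d(1)] by blast
  show thesis
  proof (rule that[OF h(1,2) e(1)])
    fix g assume "\<forall>i<N. dist (h i) (g i) < e"
    then have "dist (seq_comp g N x) (seq_comp h N x) < d" for x
      by (intro e(2)) (simp add: dist_commute)
    then show "\<not> connected (stage g R N)"
      by (intro d(2)) (simp add: seq_comp_eq_poly_ext Q_def)
  qed
qed

section \<open>Sequences repeating a word: category and measure\<close>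

text \<open>A basic open set of the product constrains finitely many coordinates only, so the word
  \<open>h\<close> can be inserted beyond them and beyond any prescribed time. This makes each
  \<open>W n\<close>, an occurrence at or after \<open>n\<close>, dense.\<close>

lemma residual_infinitely_often_block:
  fixes S :: "'a::topological_space set" and N :: nat
  assumes X: "\<And>i. i < N \<Longrightarrow> open (X i)" and h: "\<And>i. i < N \<Longrightarrow> h i \<in> X i \<inter> S"
  shows "residual_in (top_of_set (UNIV \<rightarrow> S)) {\<gamma> \<in> UNIV \<rightarrow> S. \<exists>\<^sub>\<infinity>m. \<forall>i<N. \<gamma> (m + i) \<in> X i}"
  unfolding residual_in_def
proof (intro conjI exI allI)
  define T where "T n = (\<Union>m\<in>{n..}. \<Inter>i\<in>{..<N}. {\<gamma>::nat \<Rightarrow> 'a. \<gamma> (m + i) \<in> X i})" for n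
  define W where "W n = (UNIV \<rightarrow> S) \<inter> T n" for n
  show "\<Inter> (range W) \<subseteq> {\<gamma> \<in> UNIV \<rightarrow> S. \<exists>\<^sub>\<infinity>m. \<forall>i<N. \<gamma> (m + i) \<in> X i}"
    unfolding INFM_nat_le W_def T_def by fastforce
  fix n
  have "open {\<gamma>::nat \<Rightarrow> 'a. \<gamma> k \<in> X i}" if "i < N" for k i
    using open_vimage[OF X[OF that] continuous_on_product_coordinates[of k]]
    by (simp add: vimage_def)
  then have "open (T n)" unfolding T_def by (intro open_UN ballI open_INT) auto
  then show "openin (top_of_set (UNIV \<rightarrow> S)) (W n)" unfolding W_def by (rule openin_open_Int)
  have "\<gamma> \<in> closure (W n)" if \<gamma>: "\<gamma> \<in> UNIV \<rightarrow> S" for \<gamma>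
  proof (rule ccontr)
    assume "\<gamma> \<notin> closure (W n)"
    then have "openin (product_topology (\<lambda>_. euclidean) UNIV) (- closure (W n))" "\<gamma> \<in> - closure (W n)"
      unfolding euclidean_product_topology by auto
    from product_topology_open_contains_basis[OF this]
    obtain Y where Y: "\<gamma> \<in> (\<Pi>\<^sub>E i\<in>UNIV. Y i)" "finite {i. Y i \<noteq> UNIV}"
      "(\<Pi>\<^sub>E i\<in>UNIV. Y i) \<subseteq> - closure (W n)" by auto
    obtain m where m: "\<And>i. Y i \<noteq> UNIV \<Longrightarrow> i < m"
      using finite_nat_set_iff_bounded Y(2) by auto
    define k where "k = max m n"
    define \<eta> where "\<eta> i = (if k \<le> i \<and> i < k + N then h (i - k) else \<gamma> i)" for i
    have "\<eta> i \<in> Y i" for i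
    proof (cases "Y i = UNIV")
      case False
      with m have "i < k" by (simp add: k_def less_max_iff_disj)
      with Y(1) show ?thesis by (auto simp: \<eta>_def PiE_iff)
    qed simp
    then have "\<eta> \<notin> W n" using Y(3) closure_subset[of "W n"] by (auto simp: PiE_iff)
    moreover have "\<eta> \<in> UNIV \<rightarrow> S" using \<gamma> h by (auto simp: \<eta>_def Pi_iff)
    moreover have "\<eta> \<in> T n"
      unfolding T_def using h by (intro UN_I[of k]) (auto simp: k_def \<eta>_def)
    ultimately show False by (simp add: W_def)
  qed
  then show "top_of_set (UNIV \<rightarrow> S) closure_of W n = topspace (top_of_set (UNIV \<rightarrow> S))"
    by (auto simp: closure_of_subtopology W_def Int_absorb1)
qed auto

text \<open>Each \<open>X i\<close> is an open set containing a point of the support, hence has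
  positive measure; almost surely all coordinates lie in the support.\<close>

lemma prob_infinitely_often_block:
  fixes \<tau> :: "polymap measure"
  assumes \<tau>: "borel_probability \<tau>" "measure_support \<tau> = \<Gamma>" "closed \<Gamma>"
    and X: "\<And>i. i < N \<Longrightarrow> open (X i)" and h: "\<And>i. i < N \<Longrightarrow> h i \<in> X i \<inter> \<Gamma>"
  shows "emeasure (\<Pi>\<^sub>M j\<in>(UNIV :: nat set). \<tau>)
    {\<gamma> \<in> UNIV \<rightarrow> \<Gamma>. \<exists>\<^sub>\<infinity>m. \<forall>i<N. \<gamma> (m + i) \<in> X i} = 1"
proof -
  interpret prob_space \<tau> using \<tau> by (simp add: borel_probability_def)
  interpret sequence_space \<tau> by unfold_locales
  have sets: "sets \<tau> = sets borel" using \<tau> by (simp add: borel_probability_def)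
  have space: "space \<tau> = UNIV" using sets_eq_imp_space_eq[OF sets] by simp
  have Xs: "X i \<in> sets \<tau>" if "i < N" for i using X[OF that] by (simp add: sets)
  have \<Gamma>s: "\<Gamma> \<in> sets \<tau>" using \<tau>(3) by (simp add: sets)
  have "emeasure \<tau> (X i) > 0" if "i < N" for i
    using X[OF that] h[OF that] \<tau>(2) by (auto simp: measure_support_def)
  then have io: "AE \<gamma> in S. \<exists>\<^sub>\<infinity>m. \<forall>i<N. \<gamma> (m + i) \<in> X i"
    by (intro AE_infinitely_often_block Xs)
  have "AE \<gamma> in S. \<gamma> j \<in> \<Gamma>" for j
    using AE_component[of j "\<lambda>f. f \<in> \<Gamma>"] AE_in_measure_support[OF \<tau>(1)] \<tau>(2) by simp
  then have "AE \<gamma> in S. \<forall>j. \<gamma> j \<in> \<Gamma>" by (simp add: AE_all_countable)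
  with io have "AE \<gamma> in S. \<gamma> \<in> {\<gamma> \<in> UNIV \<rightarrow> \<Gamma>. \<exists>\<^sub>\<infinity>m. \<forall>i<N. \<gamma> (m + i) \<in> X i}"
    by eventually_elim auto
  \<comment> \<open>\<open>emeasure\<close> returns 0 on non-measurable sets, so the almost sure
    statement yields the value 1 only together with measurability.\<close>
  moreover have "{\<gamma> \<in> space S. (\<forall>j. \<gamma> j \<in> \<Gamma>) \<and> (\<forall>n. \<exists>m\<ge>n. \<forall>i<N. \<gamma> (m + i) \<in> X i)} \<in> sets S"
    using Xs \<Gamma>s by measurable
  then have "{\<gamma> \<in> UNIV \<rightarrow> \<Gamma>. \<exists>\<^sub>\<infinity>m. \<forall>i<N. \<gamma> (m + i) \<in> X i} \<in> sets S"
    unfolding INFM_nat_le by (simp add: space_PiM space PiE_UNIV_domain Pi_iff)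
  ultimately show ?thesis using P.emeasure_eq_1_AE by blast
qed

theorem theorem3p38:
  fixes \<Gamma> :: "polymap set" and G :: "(riemann_sphere \<Rightarrow> riemann_sphere) set"
  assumes "\<Gamma> \<noteq> {}" and "compact \<Gamma>"
    and "G = generated_semigroup (as_map ` \<Gamma>)"
    and "\<not> bounded (Fin -` planar_postcritical G)"
  shows "\<exists>U :: (nat \<Rightarrow> polymap) set.
    residual_in (top_of_set (UNIV \<rightarrow> \<Gamma>)) U \<and>
    (\<forall>\<tau> :: polymap measure. borel_probability \<tau> \<and> measure_support \<tau> = \<Gamma> \<longrightarrow>
       emeasure (\<Pi>\<^sub>M j\<in>(UNIV :: nat set). \<tau>) U = 1) \<and>
    (\<forall>\<gamma>\<in>U. uncountable (components (julia \<gamma>)))"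
proof -
  obtain R where R: "escape_radius \<Gamma> R" using compact_imp_escape_radius[OF assms(2)] .
  obtain h N e where h: "\<And>i. h i \<in> \<Gamma>" "N > 0" "e > 0"
    "\<And>g. (\<forall>i<N. dist (h i) (g i) < e) \<Longrightarrow> \<not> connected (stage g R N)"
    using unbounded_postcritical_imp_stable_splitting[OF R assms(4)[unfolded assms(3)]] by metis
  \<comment> \<open>The set depends on the word and on \<open>e\<close> but on no measure, so it
    serves all \<open>\<tau>\<close> at once.\<close>
  define U where "U = {\<gamma> \<in> UNIV \<rightarrow> \<Gamma>. \<exists>\<^sub>\<infinity>m. \<forall>i<N. \<gamma> (m + i) \<in> ball (h i) e}"
  have h_ball: "h i \<in> ball (h i) e \<inter> \<Gamma>" for i using h by simp
  show ?thesis
  proof (intro exI[of _ U] conjI allI impI ballI)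
    show "residual_in (top_of_set (UNIV \<rightarrow> \<Gamma>)) U"
      unfolding U_def by (rule residual_infinitely_often_block[OF open_ball h_ball])
    fix \<tau> :: "polymap measure" assume \<tau>: "borel_probability \<tau> \<and> measure_support \<tau> = \<Gamma>"
    then show "emeasure (\<Pi>\<^sub>M j\<in>(UNIV :: nat set). \<tau>) U = 1"
      unfolding U_def
      by (intro prob_infinitely_often_block[OF _ _ _ open_ball h_ball])
         (use assms(2) compact_imp_closed in auto)
  next
    fix \<gamma> assume \<gamma>: "\<gamma> \<in> U"
    then have "\<exists>\<^sub>\<infinity>m. \<forall>i<N. \<gamma> (m + i) \<in> ball (h i) e" by (simp add: U_def)
    then have "\<exists>\<^sub>\<infinity>m. \<not> connected (stage (\<lambda>i. \<gamma> (m + i)) R N)"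
      by (rule INFM_mono) (intro h(4), simp)
    moreover have "\<gamma> i \<in> \<Gamma>" for i using \<gamma> by (auto simp: U_def)
    ultimately show "uncountable (components (julia \<gamma>))"
      using uncountable_components_julia_if_infinitely_many_splittings[OF R _ _ h(2)] by blast
  qed
qed

end
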